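(* Let $\delta>-1$ and $$\phi=\phi(\delta)=\tfrac12\big(1+\tfrac12\delta\big)\Big[1+\sqrt{1+4\big(1+\tfrac12\delta\big)^{-1}}\,\Big].$$ There exist finite positive constants $C_1,C_2$ such that the tail $p_\delta(\ge k)=\sum_{l=k}^\infty p_\delta(l)$ of the limiting degree distribution of the self-reinforced preferential attachment tree satisfies $$C_1k^{-\phi(\delta)}\le p_\delta(\ge k)\le C_2k^{-\phi(\delta)},\qquad k\ge1 .$$
   Context: Fix $\delta>-1$. Define random variables $E_1,E_2,\dots>0$ recursively, with $\sigma_k=\sum_{i=1}^kE_i$, $\sigma_0=0$: given $E_1,\dots,E_{k-1}$, the variable $E_k$ has hazard rate $$h_k(x)=\frac{1+\delta}{1+\frac12\delta}\big(1-e^{-(x+\sigma_{k-1})}\big)+\frac{1}{1+\frac12\delta}\sum_{j=1}^{k-1}\big(1-e^{-(\sigma_{k-1}-\sigma_j+x)}\big),\quad x\ge 0,$$ i.e. $\mathbb{P}(E_k>s\mid\sigma_1,\dots,\sigma_{k-1})=\exp(-\int_0^sh_k(x)\,dx)$. Let $T_1$ be a rate-$1$ exponential random variable independent of $(E_j)_{j\ge1}$. The limiting degree distribution is $$p_\delta(k)=\mathbb{P}\Big(\sum_{j=1}^{k-1}E_j\le T_1<\sum_{j=1}^kE_j\Big),\qquad k\ge1 .$$ *)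

theory Defs
  imports "HOL-Probability.Probability"
begin

definition partial_sum :: "(nat \<Rightarrow> 'a \<Rightarrow> real) \<Rightarrow> nat \<Rightarrow> 'a \<Rightarrow> real" where
  "partial_sum E k \<omega> = (\<Sum>i=1..k. E i \<omega>)"

text \<open>The hazard rate \<open>h\<^sub>k(x)\<close> given the earlier partial sums, where \<open>s j\<close> is the value of \<open>\<sigma>\<^sub>j\<close>.
  Only used for \<open>k \<ge> 1\<close>.\<close>

definition hazard :: "real \<Rightarrow> nat \<Rightarrow> (nat \<Rightarrow> real) \<Rightarrow> real \<Rightarrow> real" where
  "hazard \<delta> k s x =
     (1 + \<delta>) / (1 + \<delta> / 2) * (1 - exp (- (x + s (k - 1))))
   + 1 / (1 + \<delta> / 2) * (\<Sum>j=1..k - 1. 1 - exp (- (s (k - 1) - s j + x)))"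

text \<open>The sigma-algebra generated by \<open>\<sigma>\<^sub>1, \<dots>, \<sigma>\<^sub>k\<^sub>-\<^sub>1\<close>.\<close>

definition past :: "'a measure \<Rightarrow> (nat \<Rightarrow> 'a \<Rightarrow> real) \<Rightarrow> nat \<Rightarrow> 'a measure" where
  "past M E k = vimage_algebra (space M) (\<lambda>\<omega>. \<lambda>j\<in>{1..<k}. partial_sum E j \<omega>)
     (\<Pi>\<^sub>M j\<in>{1..<k}. borel)"

text \<open>A realisation of \<open>(E\<^sub>k)\<^sub>k\<^sub>\<ge>\<^sub>1\<close> and \<open>T\<^sub>1\<close>. The variable \<open>E 0\<close> is unconstrained and never used.
  Independence is stated through the generated sigma-algebras because \<^const>\<open>prob_space.indep_var\<close>
  requires both variables to have the same type.\<close>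

locale self_reinforced_model = prob_space M
  for M :: "'a measure" +
  fixes \<delta> :: real and E :: "nat \<Rightarrow> 'a \<Rightarrow> real" and T :: "'a \<Rightarrow> real"
  assumes E_measurable: "1 \<le> k \<Longrightarrow> E k \<in> borel_measurable M"
    and E_pos: "1 \<le> k \<Longrightarrow> AE \<omega> in M. 0 < E k \<omega>"
    and E_hazard: "1 \<le> k \<Longrightarrow> 0 \<le> s \<Longrightarrow>
      AE \<omega> in M. real_cond_exp M (past M E k) (indicator {\<omega> \<in> space M. s < E k \<omega>}) \<omega>
        = exp (- (LBINT x:{0..s}. hazard \<delta> k (\<lambda>j. partial_sum E j \<omega>) x))"
    and T_exponential: "distributed M lborel T (exponential_density 1)"
    and T_indep: "indep_set (sets (vimage_algebra (space M) T borel))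
      (sets (vimage_algebra (space M) (\<lambda>\<omega>. \<lambda>j\<in>{1..}. E j \<omega>) (\<Pi>\<^sub>M j\<in>{1..}. borel)))"

text \<open>\<open>p\<^sub>\<delta>(k)\<close>, for \<open>k \<ge> 1\<close>, computed in a given realisation, and its tail \<open>p\<^sub>\<delta>(\<ge> k)\<close>.\<close>

definition limit_degree :: "'a measure \<Rightarrow> (nat \<Rightarrow> 'a \<Rightarrow> real) \<Rightarrow> ('a \<Rightarrow> real) \<Rightarrow> nat \<Rightarrow> real" where
  "limit_degree M E T k =
     measure M {\<omega> \<in> space M. (\<Sum>j=1..k - 1. E j \<omega>) \<le> T \<omega> \<and> T \<omega> < (\<Sum>j=1..k. E j \<omega>)}"

definition limit_degree_tail :: "'a measure \<Rightarrow> (nat \<Rightarrow> 'a \<Rightarrow> real) \<Rightarrow> ('a \<Rightarrow> real) \<Rightarrow> nat \<Rightarrow> real" where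
  "limit_degree_tail M E T k = (\<Sum>l. limit_degree M E T (k + l))"

definition tail_exponent :: "real \<Rightarrow> real" where
  "tail_exponent \<delta> = 1 / 2 * (1 + \<delta> / 2) * (1 + sqrt (1 + 4 * inverse (1 + \<delta> / 2)))"



lemma set_integral_hazard:
  assumes "0 \<le> s"
  shows "(LBINT x:{0..s}. hazard \<delta> (Suc n) \<sigma> x) =
    ((1 + \<delta>) / (1 + \<delta> / 2) + 1 / (1 + \<delta> / 2) * real n) * s -
    ((1 + \<delta>) / (1 + \<delta> / 2) * exp (- \<sigma> n) + 1 / (1 + \<delta> / 2) * (\<Sum>j=1..n. exp (- (\<sigma> n - \<sigma> j)))) *
      (1 - exp (- s))"
proof -
  define c where "c = (1 + \<delta>) / (1 + \<delta> / 2)"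
  define d where "d = 1 / (1 + \<delta> / 2)"
  define A where "A = c + d * real n"
  define B where "B = c * exp (- \<sigma> n) + d * (\<Sum>j=1..n. exp (- (\<sigma> n - \<sigma> j)))"
  have h: "hazard \<delta> (Suc n) \<sigma> x = A - B * exp (- x)" for x
  proof -
    have "exp (- (x + \<sigma> n)) = exp (- \<sigma> n) * exp (- x)"
      by (simp flip: exp_add)
    moreover have "(\<Sum>j=1..n. 1 - exp (- (\<sigma> n - \<sigma> j + x))) =
       real n - (\<Sum>j=1..n. exp (- (\<sigma> n - \<sigma> j))) * exp (- x)"
      unfolding sum_subtractf sum_distrib_right
      by (auto simp flip: exp_add intro!: sum.cong)
    ultimately have "hazard \<delta> (Suc n) \<sigma> x = c * (1 - exp (- \<sigma> n) * exp (- x)) +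
      d * (real n - (\<Sum>j=1..n. exp (- (\<sigma> n - \<sigma> j))) * exp (- x))"
      unfolding hazard_def c_def[symmetric] d_def[symmetric] by simp
    then show ?thesis
      unfolding A_def B_def by (simp add: algebra_simps)
  qed
  have "(LBINT x:{0..s}. A - B * exp (- x)) = (A * s + B * exp (- s)) - (A * 0 + B * exp (- 0))"
    unfolding set_lebesgue_integral_def
    by (rule integral_FTC_atLeastAtMost[OF assms])
      (auto intro!: derivative_eq_intros continuous_intros
        simp flip: has_real_derivative_iff_has_vector_derivative)
  also have "\<dots> = A * s - B * (1 - exp (- s))"
    by (simp add: algebra_simps)
  finally show ?thesis
    unfolding h unfolding A_def B_def c_def d_def .
qed

lemma cumulative_hazard_strict_mono:
  fixes A B s t :: real
  assumes "0 < B" "B \<le> A" "0 \<le> s" "s < t"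
  shows "A * s - B * (1 - exp (- s)) < A * t - B * (1 - exp (- t))"
proof -
  have "1 + (s - t) < exp (s - t)"
    using exp_minus_greater[of "t - s"] assms by simp
  have "exp (- s) - exp (- t) < t - s"
  proof -
    have "exp (- s) - exp (- t) = exp (- s) * (1 - exp (s - t))"
      by (simp add: algebra_simps flip: exp_add)
    also have "\<dots> \<le> 1 * (1 - exp (s - t))"
      using assms by (intro mult_right_mono) auto
    also have "\<dots> < t - s" using \<open>1 + (s - t) < exp (s - t)\<close> by simp
    finally show ?thesis .
  qed
  then have "B * (exp (- s) - exp (- t)) < B * (t - s)"
    using assms by simp
  also have "\<dots> \<le> A * (t - s)"
    using assms by simp
  finally show ?thesis by (simp add: algebra_simps)
qed

lemma inverse_cumulative_hazard:
  obtains G :: "real \<Rightarrow> real \<Rightarrow> real \<Rightarrow> real" where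
    "\<And>A B x. 0 < G A B x"
    "\<And>A B x s. \<lbrakk>0 < B; B \<le> A; 0 < x; 0 \<le> s\<rbrakk> \<Longrightarrow> s < G A B x \<longleftrightarrow> A * s - B * (1 - exp (- s)) < x"
proof -
  define H where "H A B s = A * s - B * (1 - exp (- s))" for A B s :: real
  have mono: "0 < B \<Longrightarrow> B \<le> A \<Longrightarrow> 0 \<le> s \<Longrightarrow> s < t \<Longrightarrow> H A B s < H A B t" for A B s t
    unfolding H_def by (rule cumulative_hazard_strict_mono)
  have ex: "\<exists>s>0. H A B s = x" if "0 < B" "B \<le> A" "0 < x" for A B x
  proof -
    have "\<exists>s. 0 \<le> s \<and> s \<le> (x + B) / A \<and> H A B s = x"
    proof (rule IVT')
      show "H A B 0 \<le> x" "0 \<le> (x + B) / A" using that by (auto simp: H_def)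
      have "A * ((x + B) / A) = x + B" using that by simp
      then show "x \<le> H A B ((x + B) / A)" using that by (simp add: H_def algebra_simps)
      show "continuous_on {0..(x + B) / A} (H A B)"
        unfolding H_def by (intro continuous_intros)
    qed
    then obtain s where s: "0 \<le> s" "H A B s = x" by blast
    moreover have "s \<noteq> 0" using s that by (auto simp: H_def)
    ultimately show ?thesis by (metis less_eq_real_def)
  qed
  define G where "G A B x = (if 0 < B \<and> B \<le> A \<and> 0 < x then SOME s. 0 < s \<and> H A B s = x else 1)"
    for A B x
  have G: "0 < G A B x" "H A B (G A B x) = x" if "0 < B" "B \<le> A" "0 < x" for A B x
    using someI_ex[OF ex[OF that, unfolded Bex_def]] that by (auto simp: G_def)
  show thesis
  proof (rule that[of G])
    show "0 < G A B x" for A B x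
      using G(1)[of B A x] by (cases "0 < B \<and> B \<le> A \<and> 0 < x") (auto simp: G_def)
    show "s < G A B x \<longleftrightarrow> A * s - B * (1 - exp (- s)) < x"
      if *: "0 < B" "B \<le> A" "0 < x" "0 \<le> s" for A B x s
    proof -
      have "s < G A B x \<longleftrightarrow> H A B s < H A B (G A B x)"
        using mono[of B A s "G A B x"] mono[of B A "G A B x" s] G[OF *(1-3)] *
        by (smt (verit))
      then show ?thesis using G[OF *(1-3)] by (simp add: H_def)
    qed
  qed
qed

lemma sets_vimage_algebra_comp_subset:
  assumes f: "f \<in> measurable K L" and r: "r \<in> X \<rightarrow> space K"
  shows "sets (vimage_algebra X (\<lambda>\<omega>. f (r \<omega>)) L) \<subseteq> sigma_sets X {r -` C \<inter> X |C. C \<in> sets K}"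
  unfolding sets_vimage_algebra
proof (rule sigma_sets_mono, safe)
  fix C assume "C \<in> sets L"
  then have "f -` C \<inter> space K \<in> sets K" by (rule measurable_sets[OF f])
  moreover have "(\<lambda>\<omega>. f (r \<omega>)) -` C \<inter> X = r -` (f -` C \<inter> space K) \<inter> X"
    using r by auto
  ultimately show "(\<lambda>\<omega>. f (r \<omega>)) -` C \<inter> X \<in> sigma_sets X {r -` C \<inter> X |C. C \<in> sets K}"
    by (intro sigma_sets.Basic) blast
qed

text \<open>The model exists for every \<open>\<delta> > -1\<close>: transform independent exponential variables by the
  inverses of the conditional cumulative hazards.\<close>

theorem self_reinforced_model_exists:
  assumes "\<delta> > -1"
  shows "\<exists>(M :: (nat \<Rightarrow> real) measure) E T. self_reinforced_model M \<delta> E T"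
proof -
  define c where "c = (1 + \<delta>) / (1 + \<delta> / 2)"
  define d where "d = 1 / (1 + \<delta> / 2)"
  have cd: "0 < c" "0 < d" using assms by (auto simp: c_def d_def)
  obtain G :: "real \<Rightarrow> real \<Rightarrow> real \<Rightarrow> real" where
    G_pos: "\<And>A B x. 0 < G A B x" and
    G_gt: "\<And>A B x s. \<lbrakk>0 < B; B \<le> A; 0 < x; 0 \<le> s\<rbrakk> \<Longrightarrow> s < G A B x \<longleftrightarrow> A * s - B * (1 - exp (- s)) < x"
    using inverse_cumulative_hazard by blast
  define A where "A n = c + d * real n" for n :: nat
  define B where "B n \<sigma> = c * exp (- \<sigma> n) + d * (\<Sum>j=1..n. exp (- (\<sigma> n - \<sigma> j)))"
    for n :: nat and \<sigma> :: "nat \<Rightarrow> real"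
  \<comment> \<open>Replacing a nonpositive argument of \<open>G\<close> by 1 makes the construction measurable.\<close>
  define g where "g n \<sigma> x = G (A n) (B n \<sigma>) (if 0 < x then x else 1)"
    for n :: nat and \<sigma> :: "nat \<Rightarrow> real" and x :: real
  define S :: "nat \<Rightarrow> (nat \<Rightarrow> real) \<Rightarrow> nat \<Rightarrow> real" where
    "S = rec_nat (\<lambda>_ _. 0) (\<lambda>n Sn \<omega>. (Sn \<omega>)(Suc n := Sn \<omega> n + g n (Sn \<omega>) (\<omega> (Suc n))))"
  have S0: "S 0 \<omega> = (\<lambda>_. 0)" for \<omega>
    by (simp add: S_def)
  have SSuc: "S (Suc n) \<omega> = (S n \<omega>)(Suc n := S n \<omega> n + g n (S n \<omega>) (\<omega> (Suc n)))" for n \<omega>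
    by (simp add: S_def)
  define E where "E k \<omega> = g (k - 1) (S (k - 1) \<omega>) (\<omega> k)" for k :: nat and \<omega> :: "nat \<Rightarrow> real"
  have E_gt0: "0 < E k \<omega>" for k \<omega>
    by (simp add: E_def g_def G_pos)
  have S_eq: "j \<le> n \<Longrightarrow> S n \<omega> j = partial_sum E j \<omega>" for n j \<omega>
  proof (induction n arbitrary: j)
    case 0 then show ?case by (simp add: S0 partial_sum_def)
  next
    case (Suc n)
    show ?case
    proof (cases "j = Suc n")
      case True
      then show ?thesis using Suc.IH[of n]
        by (simp add: SSuc partial_sum_def E_def)
    next
      case False
      then show ?thesis using Suc by (simp add: SSuc)
    qed
  qed
  have ps_mono: "partial_sum E j \<omega> \<le> partial_sum E n \<omega>" if "j \<le> n" for j n \<omega>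
    unfolding partial_sum_def using that less_imp_le[OF E_gt0]
    by (intro sum_mono2) auto
  have ps_nonneg: "0 \<le> partial_sum E n \<omega>" for n \<omega>
    using ps_mono[of 0 n \<omega>] by (simp add: partial_sum_def)
  have B_cong: "B n (S n \<omega>) = B n (\<lambda>j. partial_sum E j \<omega>)" for n \<omega>
    by (simp add: B_def S_eq)
  have B_pos: "0 < B n \<sigma>" for n \<sigma>
    unfolding B_def using cd by (intro add_pos_nonneg mult_pos_pos mult_nonneg_nonneg sum_nonneg) auto
  have B_le: "B n (S n \<omega>) \<le> A n" for n \<omega>
  proof -
    have "(\<Sum>j=1..n. exp (- (partial_sum E n \<omega> - partial_sum E j \<omega>))) \<le> (\<Sum>j=1..n. 1)"
      by (intro sum_mono) (auto simp: ps_mono)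
    then show ?thesis
      unfolding B_cong unfolding B_def A_def using cd ps_nonneg[of n \<omega>]
      by (intro add_mono mult_left_mono) auto
  qed
  have S_local: "(\<And>i. i \<in> {1..n} \<Longrightarrow> \<omega> i = \<omega>' i) \<Longrightarrow> S n \<omega> = S n \<omega>'" for n \<omega> \<omega>'
  proof (induction n)
    case 0 then show ?case by (simp add: S0)
  next
    case (Suc n)
    have "S n \<omega> = S n \<omega>'" by (rule Suc.IH) (auto intro: Suc.prems)
    moreover have "\<omega> (Suc n) = \<omega>' (Suc n)" by (rule Suc.prems) auto
    ultimately show ?case by (simp add: SSuc)
  qed
  define H where "H n \<sigma> s = A n * s - B n \<sigma> * (1 - exp (- s))"
    for n :: nat and \<sigma> :: "nat \<Rightarrow> real" and s :: real
  have H_nonneg: "0 \<le> H n (S n \<omega>) s" if "0 \<le> s" for n \<omega> s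
    using that cumulative_hazard_strict_mono[of "B n (S n \<omega>)" "A n" 0 s] B_pos[of n "S n \<omega>"] B_le[of n \<omega>]
    by (cases "s = 0") (auto simp: H_def)
  have g_gt: "s < g n (S n \<omega>) x \<longleftrightarrow> H n (S n \<omega>) s < (if 0 < x then x else 1)" if "0 \<le> s" for s n \<omega> x
    unfolding g_def H_def by (rule G_gt[OF B_pos B_le _ that]) auto

  define N where "N = density lborel (exponential_density 1)"
  have sets_N [measurable_cong]: "sets N = sets borel" by (simp add: N_def)
  have space_N [simp]: "space N = UNIV" by (simp add: N_def)
  interpret N: prob_space N unfolding N_def by (rule prob_space_exponential_density) simp
  define M where "M = (\<Pi>\<^sub>M i\<in>(UNIV::nat set). N)"
  interpret P: product_prob_space "\<lambda>_. N" "UNIV :: nat set" ..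
  interpret M: prob_space M unfolding M_def by (rule P.prob_space_axioms)
  have space_M [simp]: "space M = UNIV" by (simp add: M_def space_PiM PiE_UNIV_domain)
  have comp [measurable]: "(\<lambda>\<omega>. \<omega> i) \<in> borel_measurable M" for i
  proof -
    have "(\<lambda>\<omega>. \<omega> i) \<in> measurable M N" unfolding M_def by measurable
    then show ?thesis by (simp add: measurable_cong_sets[OF refl sets_N])
  qed
  have comp_distr: "distr M N (\<lambda>\<omega>. \<omega> i) = N" for i
    unfolding M_def by (rule P.PiM_component) simp
  have exp_distr: "distributed M lborel (\<lambda>\<omega>. \<omega> i) (exponential_density 1)" for i
  proof -
    have "distr M lborel (\<lambda>\<omega>. \<omega> i) = distr M N (\<lambda>\<omega>. \<omega> i)"
      by (rule distr_cong) (simp_all add: sets_N)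
    then show ?thesis
      using comp[of i] unfolding distributed_def comp_distr by (simp add: N_def)
  qed
  have indep: "M.indep_vars (\<lambda>_. N) (\<lambda>i \<omega>. \<omega> i) UNIV"
  proof (subst M.indep_vars_iff_distr_eq_PiM')
    show "UNIV \<noteq> ({} :: nat set)" by simp
    show "(\<lambda>\<omega>. \<omega> i) \<in> measurable M N" for i unfolding M_def by measurable
    show "distr M (Pi\<^sub>M UNIV (\<lambda>_. N)) (\<lambda>x. \<lambda>i\<in>UNIV. x i) =
        (\<Pi>\<^sub>M i\<in>UNIV. distr M N (\<lambda>\<omega>. \<omega> i))"
      unfolding comp_distr by (simp add: M_def distr_id restrict_def)
  qed
  have indep_blocks: "M.indep_var (PiM I (\<lambda>_. N)) (\<lambda>\<omega>. restrict \<omega> I) (PiM J (\<lambda>_. N)) (\<lambda>\<omega>. restrict \<omega> J)"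
    if "I \<inter> J = {}" for I J
    using M.indep_var_restrict[OF indep that] by simp


  have H_meas: "(\<lambda>\<omega>. H n (S n \<omega>) s) \<in> borel_measurable K"
    if S: "\<And>j. j \<le> n \<Longrightarrow> (\<lambda>\<omega>. S n \<omega> j) \<in> borel_measurable K" for n s K
  proof -
    have [measurable]: "(\<lambda>\<omega>. S n \<omega> n) \<in> borel_measurable K" by (rule S) simp
    have [measurable]: "(\<lambda>\<omega>. \<Sum>j=1..n. exp (- (S n \<omega> n - S n \<omega> j))) \<in> borel_measurable K"
    proof (rule borel_measurable_sum)
      fix j assume "j \<in> {1..n}"
      then have [measurable]: "(\<lambda>\<omega>. S n \<omega> j) \<in> borel_measurable K" by (intro S) simp
      show "(\<lambda>\<omega>. exp (- (S n \<omega> n - S n \<omega> j))) \<in> borel_measurable K" by measurable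
    qed
    show ?thesis unfolding H_def B_def by measurable
  qed
  have g_meas: "(\<lambda>\<omega>. g n (S n (u \<omega>)) (v \<omega>)) \<in> borel_measurable K"
    if [measurable]: "\<And>s. (\<lambda>\<omega>. H n (S n (u \<omega>)) s) \<in> borel_measurable K" "v \<in> borel_measurable K" for n u v K
  proof (unfold borel_measurable_iff_greater, intro allI)
    fix s
    show "{\<omega> \<in> space K. s < g n (S n (u \<omega>)) (v \<omega>)} \<in> sets K"
    proof (cases "0 \<le> s")
      case True
      show ?thesis unfolding g_gt[OF True] by measurable
    next
      case False
      then have "{\<omega> \<in> space K. s < g n (S n (u \<omega>)) (v \<omega>)} = space K"
        using G_pos by (auto simp: g_def intro: less_trans[of s 0])
      then show ?thesis by simp
    qed
  qed
  have coord: "(\<lambda>\<omega>. \<omega> i) \<in> borel_measurable (PiM I (\<lambda>_. N))" if "i \<in> I" for i and I :: "nat set"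
  proof -
    have "(\<lambda>\<omega>. \<omega> i) \<in> measurable (PiM I (\<lambda>_. N)) N" using that by measurable
    then show ?thesis by (simp add: measurable_cong_sets[OF refl sets_N])
  qed
  have S_meas: "(\<lambda>\<omega>. S n \<omega> j) \<in> borel_measurable (PiM I (\<lambda>_. N))" if "{1..n} \<subseteq> I" for n I j
    using that
  proof (induction n arbitrary: j)
    case 0 then show ?case by (simp add: S0)
  next
    case (Suc n)
    have IH [measurable]: "(\<lambda>\<omega>. S n \<omega> j) \<in> borel_measurable (PiM I (\<lambda>_. N))" for j
      using Suc by (intro Suc.IH) auto
    have [measurable]: "(\<lambda>\<omega>. \<omega> (Suc n)) \<in> borel_measurable (PiM I (\<lambda>_. N))"
      using Suc.prems by (intro coord) auto
    have [measurable]: "(\<lambda>\<omega>. g n (S n \<omega>) (\<omega> (Suc n))) \<in> borel_measurable (PiM I (\<lambda>_. N))"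
      by (intro g_meas H_meas) auto
    show ?case by (cases "j = Suc n") (simp_all add: SSuc)
  qed
  have E_meas: "E k \<in> borel_measurable (PiM I (\<lambda>_. N))" if k: "1 \<le> k" "{1..k} \<subseteq> I" for k I
  proof -
    have "{1..k - 1} \<subseteq> I" "k \<in> I"
      using k by (auto intro!: subsetD[OF k(2)])
    then show ?thesis
      unfolding E_def by (intro g_meas H_meas S_meas coord)
  qed

  have "self_reinforced_model M \<delta> E (\<lambda>\<omega>. \<omega> 0)"
  proof
    show "E k \<in> borel_measurable M" if "1 \<le> k" for k
      unfolding M_def by (rule E_meas[OF that]) simp
    have E_restrict: "E j (restrict \<omega> {1..}) = E j \<omega>" if "1 \<le> j" for j \<omega>
      unfolding E_def using that S_local[of "j - 1" "restrict \<omega> {1..}" \<omega>] by simp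
    show "AE \<omega> in M. 0 < E k \<omega>" if "1 \<le> k" for k
      by (simp add: E_gt0)
    show "distributed M lborel (\<lambda>\<omega>. \<omega> 0) (exponential_density 1)" by (rule exp_distr)
    show "M.indep_set (sets (vimage_algebra (space M) (\<lambda>\<omega>. \<omega> 0) borel))
      (sets (vimage_algebra (space M) (\<lambda>\<omega>. \<lambda>j\<in>{1..}. E j \<omega>) (\<Pi>\<^sub>M j\<in>{1..}. borel)))"
    proof -
      have "sets (vimage_algebra (space M) (\<lambda>\<omega>. (restrict \<omega> {0}) 0) borel)
         \<subseteq> sigma_sets (space M) {(\<lambda>\<omega>. restrict \<omega> {0}) -` C \<inter> space M |C. C \<in> sets (PiM {0} (\<lambda>_. N))}"
        by (rule sets_vimage_algebra_comp_subset[where f = "\<lambda>\<omega>. \<omega> 0"]) (auto intro: coord simp: space_PiM split: if_splits)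
      moreover have "sets (vimage_algebra (space M)
           (\<lambda>\<omega>. \<lambda>j\<in>{1..}. E j (restrict \<omega> {1..})) (\<Pi>\<^sub>M j\<in>{1..}. borel))
         \<subseteq> sigma_sets (space M) {(\<lambda>\<omega>. restrict \<omega> {1..}) -` C \<inter> space M |C. C \<in> sets (PiM {1..} (\<lambda>_. N))}"
        by (rule sets_vimage_algebra_comp_subset[where f = "\<lambda>\<omega>. \<lambda>j\<in>{1..}. E j \<omega>"])
          (auto intro!: measurable_restrict E_meas simp: space_PiM split: if_splits)
      moreover have "M.indep_set
          (sigma_sets (space M) {(\<lambda>\<omega>. restrict \<omega> {0}) -` C \<inter> space M |C. C \<in> sets (PiM {0} (\<lambda>_. N))})
          (sigma_sets (space M) {(\<lambda>\<omega>. restrict \<omega> {1..}) -` C \<inter> space M |C. C \<in> sets (PiM {1..} (\<lambda>_. N))})"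
        using indep_blocks[of "{0}" "{1..}"] unfolding M.indep_var_eq by simp
      ultimately have "M.indep_set (sets (vimage_algebra (space M) (\<lambda>\<omega>. (restrict \<omega> {0}) 0) borel))
         (sets (vimage_algebra (space M) (\<lambda>\<omega>. \<lambda>j\<in>{1..}. E j (restrict \<omega> {1..})) (\<Pi>\<^sub>M j\<in>{1..}. borel)))"
        unfolding M.indep_set_def
        by (elim M.indep_sets_mono_sets) (auto split: bool.split)
      moreover have "(\<lambda>\<omega>. \<lambda>j\<in>{1..}. E j (restrict \<omega> {1..})) = (\<lambda>\<omega>. \<lambda>j\<in>{1..}. E j \<omega>)"
        by (intro ext restrict_ext E_restrict) auto
      ultimately show ?thesis by simp
    qed
    show "AE \<omega> in M. real_cond_exp M (past M E k) (indicator {\<omega> \<in> space M. s < E k \<omega>}) \<omega>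
        = exp (- (LBINT x:{0..s}. hazard \<delta> k (\<lambda>j. partial_sum E j \<omega>) x))"
      if "1 \<le> k" "0 \<le> s" for k s
    proof -
      obtain n where k: "k = Suc n" using \<open>1 \<le> k\<close> by (cases k) auto
      note s = \<open>0 \<le> s\<close>
      let ?J = "{1..n}" and ?K = "{k}"
      let ?PJ = "PiM ?J (\<lambda>_. N)" and ?PK = "PiM ?K (\<lambda>_. N)"
      let ?r = "\<lambda>\<omega>. restrict \<omega> ?J" and ?q = "\<lambda>\<omega>. restrict \<omega> ?K"
      define V where "V \<omega> = (\<lambda>j\<in>{1..<k}. S n \<omega> j)" for \<omega>
      let ?L = "\<Pi>\<^sub>M j\<in>{1..<k}. (borel :: real measure)"
      define F where "F = past M E k"
      have V_eq: "(\<lambda>\<omega>. \<lambda>j\<in>{1..<k}. partial_sum E j \<omega>) = V"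
        unfolding V_def by (intro ext restrict_ext) (simp add: S_eq k)
      have F_eq: "F = vimage_algebra (space M) V ?L"
        unfolding F_def past_def V_eq ..
      have V_meas [measurable]: "V \<in> measurable M ?L"
        unfolding V_def M_def by (intro measurable_restrict S_meas) auto
      have V_measJ [measurable]: "V \<in> measurable ?PJ ?L"
        unfolding V_def by (intro measurable_restrict S_meas) auto
      have space_F: "space F = space M" by (simp add: F_eq)
      have V_fun: "V \<in> space M \<rightarrow> space ?L"
        using measurable_space[OF V_meas] by (rule funcsetI)
      have sets_F: "sets F = {V -` C \<inter> space M |C. C \<in> sets ?L}"
        unfolding F_eq by (rule sets_vimage_algebra2[OF V_fun])
      have "sets F \<subseteq> sets M"
        unfolding sets_F using measurable_sets[OF V_meas] by blast
      then have subalg: "subalgebra M F"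
        unfolding subalgebra_def by (simp add: space_F)
      interpret F: finite_measure_subalgebra M F
        by standard (rule subalg)
      have r_meas [measurable]: "?r \<in> measurable M ?PJ"
        unfolding M_def by (rule measurable_restrict_subset) simp
      have q_meas [measurable]: "?q \<in> measurable M ?PK"
        unfolding M_def by (rule measurable_restrict_subset) simp
      have S_r: "S n (?r \<omega>) = S n \<omega>" for \<omega>
        by (rule S_local) simp
      have V_r: "V (?r \<omega>) = V \<omega>" for \<omega>
        unfolding V_def S_r ..
      have SF: "(\<lambda>\<omega>. S n \<omega> j) \<in> borel_measurable F" if "j \<le> n" for j
      proof (cases "j = 0")
        case True
        then show ?thesis using that by (simp add: S_eq partial_sum_def)
      next
        case False
        then have j: "j \<in> {1..<k}" using that k by auto
        have "V \<in> measurable F ?L"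
          unfolding F_eq by (rule measurable_vimage_algebra1[OF V_fun])
        then have "(\<lambda>\<omega>. V \<omega> j) \<in> borel_measurable F"
          using measurable_compose[OF _ measurable_component_singleton[OF j]] by blast
        then show ?thesis using j by (simp add: V_def)
      qed
      have HF [measurable]: "(\<lambda>\<omega>. H n (S n \<omega>) s) \<in> borel_measurable F"
        by (intro H_meas SF)
      have HM [measurable]: "(\<lambda>\<omega>. H n (S n \<omega>) t) \<in> borel_measurable M" for t
        unfolding M_def by (intro H_meas S_meas) simp
      have HJ: "(\<lambda>\<omega>. H n (S n \<omega>) t) \<in> borel_measurable ?PJ" for t
        by (intro H_meas S_meas) simp
      note [measurable] = HJ
      have Ek [measurable]: "E k \<in> borel_measurable M"
        unfolding M_def by (rule E_meas) (use k in auto)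
      have E_k: "E k \<omega> = g n (S n \<omega>) (\<omega> k)" for \<omega>
        by (simp add: E_def k)

      have pos: "AE \<omega> in M. 0 < \<omega> k"
        using M.exponential_distributedD_gt[OF exp_distr, of 0 k]
        by (subst M.prob_Collect_eq_1[symmetric]) (measurable, simp?)
      have tail: "measure M {\<omega> \<in> space M. s < g n (S n y) (\<omega> k)} = exp (- H n (S n y) s)" for y
      proof -
        have [measurable]: "(\<lambda>\<omega>. g n (S n y) (\<omega> k)) \<in> borel_measurable M"
          by (intro g_meas) auto
        have "measure M {\<omega> \<in> space M. s < g n (S n y) (\<omega> k)} =
            measure M {\<omega> \<in> space M. H n (S n y) s < \<omega> k}"
        proof (rule M.finite_measure_eq_AE)
          show "AE \<omega> in M. \<omega> \<in> {\<omega> \<in> space M. s < g n (S n y) (\<omega> k)} \<longleftrightarrow>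
              \<omega> \<in> {\<omega> \<in> space M. H n (S n y) s < \<omega> k}"
            using pos by eventually_elim (simp add: g_gt[OF s])
        qed measurable
        then show ?thesis
          using M.exponential_distributedD_gt[OF exp_distr H_nonneg[OF s, of n y], of k] by simp
      qed

      have int: "(\<integral>\<omega>. indicator C (V \<omega>) * indicator {\<omega> \<in> space M. s < E k \<omega>} \<omega> \<partial>M) =
          (\<integral>\<omega>. indicator C (V \<omega>) * exp (- H n (S n \<omega>) s) \<partial>M :: real)"
        if C [measurable]: "C \<in> sets ?L" for C
      proof -
        define Q :: "(nat \<Rightarrow> real) \<times> (nat \<Rightarrow> real) \<Rightarrow> real" where
          "Q = (\<lambda>(y, x). indicator C (V y) * indicator {s<..} (g n (S n y) (x k)))"
        define R :: "(nat \<Rightarrow> real) \<Rightarrow> real" where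
          "R y = indicator C (V y) * exp (- H n (S n y) s)" for y
        let ?D = "distr M ?PJ ?r" and ?D' = "distr M ?PK ?q"
        have [measurable]: "(\<lambda>x. x k) \<in> borel_measurable ?PK" by (rule coord) simp
        have gQ [measurable]: "(\<lambda>p. g n (S n (fst p)) (snd p k)) \<in> borel_measurable (?PJ \<Otimes>\<^sub>M ?PK)"
          by (rule g_meas) measurable
        have Q_meas [measurable]: "Q \<in> borel_measurable (?PJ \<Otimes>\<^sub>M ?PK)"
          unfolding Q_def split_beta' by measurable
        have R_meas [measurable]: "R \<in> borel_measurable ?PJ"
          unfolding R_def by measurable
        have joint: "distr M (?PJ \<Otimes>\<^sub>M ?PK) (\<lambda>\<omega>. (?r \<omega>, ?q \<omega>)) = ?D \<Otimes>\<^sub>M ?D'"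
          using indep_blocks[of ?J ?K] k unfolding M.indep_var_distribution_eq by simp
        interpret D: prob_space ?D by (rule M.prob_space_distr) simp
        interpret D': prob_space ?D' by (rule M.prob_space_distr) simp
        interpret DD: pair_prob_space ?D ?D' ..
        have Q_bd: "norm (Q p) \<le> 1" for p
          by (auto simp: Q_def split: prod.split split_indicator)
        have "(\<integral>\<omega>. indicator C (V \<omega>) * indicator {\<omega> \<in> space M. s < E k \<omega>} \<omega> \<partial>M) =
            (\<integral>\<omega>. Q (?r \<omega>, ?q \<omega>) \<partial>M)"
          by (intro Bochner_Integration.integral_cong refl)
            (auto simp: Q_def V_r S_r E_k simp del: One_nat_def split: split_indicator)
        also have "\<dots> = (\<integral>p. Q p \<partial>(?D \<Otimes>\<^sub>M ?D'))"
          unfolding joint[symmetric] by (rule integral_distr[symmetric]) measurable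
        also have "\<dots> = (\<integral>y. (\<integral>x. Q (y, x) \<partial>?D') \<partial>?D)"
        proof (rule DD.integral_fst'[symmetric], rule DD.integrable_const_bound[where B = 1])
          show "AE p in ?D \<Otimes>\<^sub>M ?D'. norm (Q p) \<le> 1" by (intro AE_I2 Q_bd)
          show "Q \<in> borel_measurable (?D \<Otimes>\<^sub>M ?D')"
            using Q_meas measurable_cong_sets[OF sets_pair_measure_cong[OF sets_distr sets_distr] refl]
            by blast
        qed
        also have "\<dots> = (\<integral>y. R y \<partial>?D)"
        proof (intro Bochner_Integration.integral_cong refl)
          fix y assume "y \<in> space ?D"
          then have y: "y \<in> space ?PJ" by simp
          have [measurable]: "(\<lambda>x. Q (y, x)) \<in> borel_measurable ?PK"
            using measurable_compose[OF measurable_Pair1'[OF y] Q_meas] by (simp add: comp_def)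
          have "(\<integral>x. Q (y, x) \<partial>?D') = (\<integral>\<omega>. Q (y, ?q \<omega>) \<partial>M)"
            by (rule integral_distr) measurable
          also have "\<dots> = (\<integral>\<omega>. indicator C (V y) * indicator {\<omega> \<in> space M. s < g n (S n y) (\<omega> k)} \<omega> \<partial>M)"
            by (intro Bochner_Integration.integral_cong refl) (auto simp: Q_def split: split_indicator)
          also have "\<dots> = R y"
            using tail[of y] by (simp add: R_def)
          finally show "(\<integral>x. Q (y, x) \<partial>?D') = R y" .
        qed
        also have "\<dots> = (\<integral>\<omega>. R (?r \<omega>) \<partial>M)"
          by (rule integral_distr) measurable
        finally show ?thesis by (simp add: R_def V_r S_r del: One_nat_def)
      qed

      have "AE \<omega> in M. real_cond_exp M F (indicator {\<omega> \<in> space M. s < E k \<omega>}) \<omega> = exp (- H n (S n \<omega>) s)"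
      proof (rule F.real_cond_exp_charact)
        show "integrable M (indicator {\<omega> \<in> space M. s < E k \<omega>} :: _ \<Rightarrow> real)"
          by (rule M.integrable_const_bound[where B = 1]) (auto split: split_indicator)
        show "integrable M (\<lambda>\<omega>. exp (- H n (S n \<omega>) s))"
          using H_nonneg[OF s] by (intro M.integrable_const_bound[where B = 1]) auto
        show "(\<lambda>\<omega>. exp (- H n (S n \<omega>) s)) \<in> borel_measurable F" by measurable
        fix X assume "X \<in> sets F"
        then obtain C where C: "C \<in> sets ?L" "X = V -` C \<inter> space M"
          unfolding sets_F by auto
        have X: "indicator X \<omega> = (indicator C (V \<omega>) :: real)" for \<omega>
          by (auto simp: C split: split_indicator)
        show "(\<integral>\<omega>\<in>X. indicator {\<omega> \<in> space M. s < E k \<omega>} \<omega> \<partial>M) = (\<integral>\<omega>\<in>X. exp (- H n (S n \<omega>) s) \<partial>M)"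
          unfolding set_lebesgue_integral_def X using int[OF C(1)] by simp
      qed
      moreover have "(LBINT x:{0..s}. hazard \<delta> k (\<lambda>j. partial_sum E j \<omega>) x) = H n (S n \<omega>) s" for \<omega>
        unfolding k set_integral_hazard[OF s] unfolding H_def B_cong unfolding A_def B_def c_def d_def ..
      ultimately show ?thesis unfolding F_def by simp
    qed
  qed
  then show ?thesis by blast
qed


end

theory Submission
  imports Defs
begin

text \<open>
The points \<open>\<sigma>\<^sub>1 < \<sigma>\<^sub>2 < \<dots>\<close> form a self-exciting point process on the half-line. Write
\<open>c = (1 + \<delta>) / (1 + \<delta>/2)\<close> and \<open>d = 1 / (1 + \<delta>/2)\<close>. After \<open>n\<close> points the intensity at time \<open>t\<close> is
\<open>A - Y\<close>, where \<open>A = c + d n\<close> is the value it would have if time \<open>0\<close> and all points lay infinitely far back, and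
\<open>Y = c e\<^sup>-\<^sup>t + d (\<Sum>j\<le>n. exp (- (t - \<sigma>\<^sub>j)))\<close> is the deficit caused by their finite distance. The deficit decays
at rate \<open>1\<close> between points, and at a point both \<open>A\<close> and \<open>Y\<close> jump by \<open>d\<close>.

A tail probability of the degree distribution is a Laplace transform. By telescoping,
\<open>p\<^sub>\<delta>(\<ge> n + 1) = P(\<sigma>\<^sub>n \<le> T) = E (exp (- \<sigma>\<^sub>n))\<close>, because \<open>T\<close> is a unit exponential variable independent of
\<open>\<sigma>\<^sub>n\<close>. So the discounted mean \<open>E (exp (- \<sigma>\<^sub>n))\<close> has to be shown to be of order \<open>n\<close> to the power \<open>- \<phi>\<close>.

The mean growth of \<open>(A, Y)\<close> is linear, with growth rate \<open>1/\<phi>\<close>; the corresponding eigenfunction is the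
weight \<open>X = A - Y / (\<phi> + 1)\<close>, which jumps by \<open>1/\<phi>\<close> at each point and lies between
\<open>\<phi> / (\<phi> + 1) A\<close> and \<open>A\<close>. Hence \<open>e\<^sup>-\<^sup>t\<close> discounts the process at the rate at which the power \<open>X\<close> to the \<open>\<phi>\<close>
grows to first order, and the second-order error has a sign that can be arranged:

\<^item> since \<open>\<phi> > 1\<close>, the power function is convex, and \<open>exp (- \<sigma>\<^sub>n) X\<^sub>n powr \<phi>\<close> has nondecreasing mean
  (\<open>powr_drift_ge\<close>);
\<^item> for a large constant \<open>b\<close>, \<open>exp (- \<sigma>\<^sub>n) (X\<^sub>n + b) powr \<phi>\<close> has nonincreasing mean (\<open>powr_drift_le\<close>).

As \<open>X\<^sub>n\<close> is comparable to \<open>n + 1\<close> by constants that depend only on \<open>\<delta>\<close>, these two facts bound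
\<open>E (exp (- \<sigma>\<^sub>n))\<close> from below and from above by multiples of \<open>n + 1\<close> to the power \<open>- \<phi>\<close>.

To pass from the infinitesimal drift inequality to the step from \<open>n\<close> to \<open>n + 1\<close>, a function of the
waiting time is written as the integral of its derivative over the event that the waiting time has
not yet elapsed. Fubini's theorem then leaves only the conditional survival probabilities, which the
hazard rates determine (\<open>conditional_drift\<close>).
\<close>

section \<open>The tail exponent\<close>

text \<open>The reciprocal \<open>\<alpha> = 1/\<phi>\<close> is a Malthusian parameter, whose equation is
\<open>\<alpha> (\<alpha> + 1) = 1 / (1 + \<delta>/2)\<close>: a point contributes the intensity
\<open>(1 - e\<^sup>-\<^sup>t) / (1 + \<delta>/2)\<close> at age \<open>t\<close>, and the Laplace transform of this function equals \<open>1\<close> at \<open>\<alpha>\<close>.\<close>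

lemma tail_exponent_quadratic:
  assumes "\<delta> > -1"
  shows "(tail_exponent \<delta>)\<^sup>2 = (1 + \<delta> / 2) * (tail_exponent \<delta> + 1)"
proof -
  define u where "u = 1 + \<delta> / 2"
  have u: "u > 1/2" using assms by (simp add: u_def)
  define r where "r = sqrt (1 + 4 * inverse u)"
  have r: "r\<^sup>2 = 1 + 4 * inverse u" using u by (simp add: r_def)
  have ur: "(u * r)\<^sup>2 = u * (u * r\<^sup>2)" by (simp add: power2_eq_square)
  have "u * r\<^sup>2 = u + 4" unfolding r using u by (simp add: field_simps)
  then have "(u * r)\<^sup>2 = u * u + 4 * u"
    unfolding ur by (simp add: distrib_left)
  then have "((u + u * r) / 2)\<^sup>2 = u * ((u + u * r) / 2 + 1)"
    by (simp add: power2_eq_square field_simps)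
  moreover have "(u + u * r) / 2 = 1 / 2 * u * (1 + r)" by (simp add: field_simps)
  ultimately have "(1 / 2 * u * (1 + r))\<^sup>2 = u * (1 / 2 * u * (1 + r) + 1)"
    by (simp only:)
  then show ?thesis unfolding tail_exponent_def r_def u_def by simp
qed

text \<open>By the quadratic equation, \<open>\<phi>\<close> equals \<open>1\<close> at \<open>1 + \<delta>/2 = 1/2\<close>, the limiting case \<open>\<delta> = -1\<close>. Convexity of
\<open>x powr \<phi>\<close>, on which the lower bound rests, is thus available for every \<open>\<delta> > -1\<close>.\<close>

lemma tail_exponent_gt_1:
  assumes "\<delta> > -1"
  shows "1 < tail_exponent \<delta>"
proof -
  define u where "u = 1 + \<delta> / 2"
  have u: "u > 1/2" using assms by (simp add: u_def)
  define r where "r = sqrt (1 + 4 * inverse u)"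
  have r: "r\<^sup>2 = 1 + 4 * inverse u" "r \<ge> 0" using u by (simp_all add: r_def)
  have ur: "(u * r)\<^sup>2 = u * (u * r\<^sup>2)" by (simp add: power2_eq_square)
  have "u * r\<^sup>2 = u + 4" unfolding r using u by (simp add: field_simps)
  then have "(u * r)\<^sup>2 = u * u + 4 * u"
    unfolding ur by (simp add: distrib_left)
  moreover have "(2 - u)\<^sup>2 = 4 - 4 * u + u * u" by (simp add: power2_eq_square algebra_simps)
  ultimately have "(2 - u)\<^sup>2 < (u * r)\<^sup>2" using u by linarith
  then have "2 - u < u * r" by (rule power2_less_imp_less) (use u r(2) in simp)
  then show ?thesis unfolding tail_exponent_def r_def u_def by (simp add: algebra_simps)
qed

section \<open>Drift of shifted powers\<close>

text \<open>The mean value theorem, with the monotone derivative of a convex power.\<close>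

lemma powr_increment_bounds:
  fixes p x h :: real
  assumes "1 \<le> p" "0 < x" "0 \<le> h"
  shows "p * x powr (p - 1) * h \<le> (x + h) powr p - x powr p"
    and "(x + h) powr p - x powr p \<le> p * (x + h) powr (p - 1) * h"
proof -
  have "p * x powr (p - 1) * h \<le> (x + h) powr p - x powr p \<and>
    (x + h) powr p - x powr p \<le> p * (x + h) powr (p - 1) * h"
  proof (cases "h = 0")
    case False
    have "\<exists>z. x < z \<and> z < x + h \<and> (x + h) powr p - x powr p = (x + h - x) * (p * z powr (p - 1))"
      using assms False
      by (intro MVT2) (auto intro!: derivative_eq_intros simp: powr_diff)
    then obtain z where z: "x < z" "z < x + h" "(x + h) powr p - x powr p = h * (p * z powr (p - 1))"
      by auto
    have "x powr (p - 1) \<le> z powr (p - 1)" "z powr (p - 1) \<le> (x + h) powr (p - 1)"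
      using z assms by (intro powr_mono2; simp)+
    then have "h * (p * x powr (p - 1)) \<le> h * (p * z powr (p - 1))"
       "h * (p * z powr (p - 1)) \<le> h * (p * (x + h) powr (p - 1))"
      using assms by (intro mult_left_mono; simp)+
    then show ?thesis unfolding z(3) by (simp add: mult_ac)
  qed simp
  then show "p * x powr (p - 1) * h \<le> (x + h) powr p - x powr p"
    "(x + h) powr p - x powr p \<le> p * (x + h) powr (p - 1) * h" by auto
qed

lemma powr_one_plus_le_linear:
  fixes q t :: real
  assumes "0 \<le> q" "0 \<le> t" "t \<le> 1"
  shows "(1 + t) powr q \<le> 1 + q * exp q * t"
proof -
  have "(1 + t) powr q = exp (q * ln (1 + t))" using assms by (simp add: powr_def)
  also have "\<dots> \<le> exp (q * t)"
    using assms ln_add_one_self_le_self[of t] by (simp add: mult_left_mono)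
  also have "\<dots> \<le> 1 + (q * t) * exp (q * t)"
  proof -
    have "(1 - q * t) * exp (q * t) \<le> exp (- (q * t)) * exp (q * t)"
      using exp_ge_add_one_self[of "- (q * t)"] by (intro mult_right_mono) auto
    then show ?thesis by (simp add: algebra_simps flip: exp_add)
  qed
  also have "\<dots> \<le> 1 + (q * t) * exp q"
    using assms by (intro add_left_mono mult_left_mono) (auto simp: mult_left_le)
  finally show ?thesis by (simp add: mult_ac)
qed

text \<open>The eigenvalue equation of the weight: with \<open>\<theta> = 1 / (p + 1)\<close>, the weight \<open>A - \<theta> y\<close> grows by \<open>\<theta> y\<close> through
the decay of the deficit and by jumps of size \<open>1/p\<close> at rate \<open>A - y\<close>, in total at \<open>1/p\<close> times its own
value. Here this is multiplied by \<open>p\<close>.\<close>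

lemma weight_drift_identity:
  fixes p :: real
  assumes "1 < p"
  shows "p * (1 / (p + 1) * y) + (A - y) = A - 1 / (p + 1) * y"
  using assms by (simp add: field_simps)

text \<open>By convexity a jump from \<open>x\<close> to \<open>x + 1/p\<close> raises \<open>x powr p\<close> by at least its first-order part
\<open>x powr (p - 1)\<close>. With that part in place of the increment, the drift is exactly \<open>x powr p\<close>,
by the eigenvalue equation.\<close>

lemma powr_drift_ge:
  fixes p A y :: real
  defines "x \<equiv> A - 1 / (p + 1) * y"
  assumes "1 < p" "0 \<le> y" "y \<le> A" "0 < A"
  shows "x powr p \<le> p * x powr (p - 1) * (1 / (p + 1) * y) + (A - y) * ((x + 1 / p) powr p - x powr p)"
proof -
  have "0 < A * p" using assms(2-5) by simp
  then have "y < A + A * p" using assms(2-5) by linarith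
  then have x: "0 < x"
    using assms(2-5) by (simp add: x_def field_simps)
  have "x powr p = x powr (p - 1) * x" using x by (simp add: powr_diff)
  also have "\<dots> = x powr (p - 1) * (p * (1 / (p + 1) * y) + (A - y))"
    using weight_drift_identity[OF assms(2), of y A] unfolding x_def by presburger
  also have "\<dots> = p * x powr (p - 1) * (1 / (p + 1) * y) + (A - y) * x powr (p - 1)"
    by (simp add: algebra_simps)
  also have "(A - y) * x powr (p - 1) \<le> (A - y) * ((x + 1 / p) powr p - x powr p)"
    using powr_increment_bounds(1)[of p x "1 / p"] x assms by (intro mult_left_mono) auto
  finally show ?thesis by simp
qed

text \<open>The jump exceeds its first-order part \<open>g powr (p - 1)\<close> by a relative error of order \<open>1/g\<close>, which after
multiplication by the jump rate \<open>A - y \<le> g\<close> is at most \<open>K g powr (p - 1)\<close> with \<open>K = (p - 1) exp (p - 1)\<close>.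
The shift by \<open>b\<close> absorbs this: the first-order drift is \<open>(g - b) g powr (p - 1)\<close>, and \<open>b \<ge> K\<close>. The
additional \<open>1\<close> in \<open>b\<close> keeps \<open>g\<close> above \<open>1\<close>, where the linear bound on the error applies.\<close>

lemma powr_drift_le:
  fixes p A y :: real
  defines "b \<equiv> 1 + (p - 1) * exp (p - 1)"
  defines "g \<equiv> A - 1 / (p + 1) * y + b"
  assumes "1 < p" "0 \<le> y" "y \<le> A" "0 < A"
  shows "p * g powr (p - 1) * (1 / (p + 1) * y) + (A - y) * ((g + 1 / p) powr p - g powr p) \<le> g powr p"
proof -
  define K where "K = (p - 1) * exp (p - 1)"
  define x where "x = A - 1 / (p + 1) * y"
  have K: "0 \<le> K" "b = 1 + K" using assms by (auto simp: K_def b_def)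
  have "0 < A * p" "0 \<le> y * p" using assms(3-6) by simp_all
  then have "y < A + A * p" "y \<le> y + y * p" using assms(3-6) by linarith+
  then have x: "0 < x" "A - y \<le> x"
    using assms(3-6) by (simp_all add: x_def field_simps)
  have g: "g = x + 1 + K" "1 \<le> g" using x K by (auto simp: g_def x_def)
  have "(g + 1 / p) powr p - g powr p \<le> (g + 1 / p) powr (p - 1)"
    using powr_increment_bounds(2)[of p g "1 / p"] g(2) assms(3) by auto
  also have "(g + 1 / p) powr (p - 1) = g powr (p - 1) * (1 + 1 / (p * g)) powr (p - 1)"
  proof -
    have "g + 1 / p = g * (1 + 1 / (p * g))" using g(2) assms(3) by (simp add: field_simps)
    then show ?thesis using g(2) assms(3) by (simp add: powr_mult)
  qed
  also have "\<dots> \<le> g powr (p - 1) * (1 + K * (1 / (p * g)))"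
    unfolding K_def using g(2) assms(3) mult_mono[of 1 p 1 g]
    by (intro mult_left_mono powr_one_plus_le_linear) auto
  finally have "(A - y) * ((g + 1 / p) powr p - g powr p) \<le> (A - y) * (g powr (p - 1) * (1 + K * (1 / (p * g))))"
    using assms(5) by (intro mult_left_mono) auto
  also have "\<dots> = g powr (p - 1) * ((A - y) + (A - y) * (K * (1 / (p * g))))"
    by (simp add: algebra_simps)
  also have "\<dots> \<le> g powr (p - 1) * ((A - y) + K)"
  proof -
    have "1 * g \<le> p * g" using g(2) assms(3) by (intro mult_right_mono) auto
    then have "A - y \<le> p * g" using x g(1) K(1) by linarith
    then have "(A - y) * (K * (1 / (p * g))) \<le> (p * g) * (K * (1 / (p * g)))"
      using g(2) K(1) assms(3) by (intro mult_right_mono) auto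
    also have "\<dots> = K" using g(2) assms(3) by simp
    finally show ?thesis by (intro mult_left_mono) auto
  qed
  finally have "p * g powr (p - 1) * (1 / (p + 1) * y) + (A - y) * ((g + 1 / p) powr p - g powr p) \<le>
     g powr (p - 1) * (p * (1 / (p + 1) * y) + (A - y) + K)" by (simp add: algebra_simps)
  also have "p * (1 / (p + 1) * y) + (A - y) = x"
    unfolding x_def by (rule weight_drift_identity) fact
  also have "g powr (p - 1) * (x + K) \<le> g powr (p - 1) * g" using g by (intro mult_left_mono) auto
  also have "\<dots> = g powr p" using g by (simp add: powr_diff)
  finally show ?thesis .
qed

section \<open>Integrals against the unit exponential law\<close>

abbreviation unit_exponential :: "real measure" where
  "unit_exponential \<equiv> density lborel (exponential_density 1)"

lemma AE_unit_exponential_nonneg: "AE s in unit_exponential. 0 \<le> s"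
  by (subst AE_density) (auto simp: exponential_density_def)

lemma AE_unit_exponential_neq: "AE s in unit_exponential. s \<noteq> t"
  by (subst AE_density) (auto intro: AE_mp[OF AE_lborel_singleton[of t]])

text \<open>The exponential law serves as reference measure because all integrands carry the discount
\<open>exp (- s)\<close>. Absorbing it into a probability measure leaves bounded integrands, so that integrability,
also on product spaces, comes from boundedness.\<close>

lemma integral_unit_exponential_FTC:
  fixes k h :: "real \<Rightarrow> real"
  assumes [measurable]: "k \<in> borel_measurable borel"
    and "0 \<le> t"
    and deriv: "\<And>s. 0 \<le> s \<Longrightarrow> s \<le> t \<Longrightarrow> (h has_real_derivative exp (- s) * k s) (at s)"
    and cont: "continuous_on {0..t} k"
  shows "(\<integral>s. indicator {..t} s * k s \<partial>unit_exponential) = h t - h 0"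
proof -
  have "(\<integral>s. indicator {..t} s * k s \<partial>unit_exponential) =
      (\<integral>s. exponential_density 1 s *\<^sub>R (indicator {..t} s * k s) \<partial>lborel)"
    by (rule integral_density) (auto simp: exponential_density_def)
  also have "\<dots> = (\<integral>s. indicator {0..t} s *\<^sub>R (exp (- s) * k s) \<partial>lborel)"
    by (intro Bochner_Integration.integral_cong refl)
      (auto simp: exponential_density_def split: split_indicator)
  also have "\<dots> = h t - h 0"
    using deriv cont \<open>0 \<le> t\<close>
    by (intro integral_FTC_atLeastAtMost continuous_intros)
      (auto simp flip: has_real_derivative_iff_has_vector_derivative intro: DERIV_subset)
  finally show ?thesis .
qed

section \<open>Drift across one waiting time\<close>

text \<open>Consider one waiting time, started with deficit \<open>b\<close>: the deficit \<open>y = b exp (- s)\<close> decays, the weight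
\<open>A - \<theta> y\<close> grows with it, and a jump by \<open>\<alpha>\<close> comes at rate \<open>A - y\<close>. The last assumption states that the
generator of this motion, applied to \<open>f\<close>, is at most \<open>f\<close>, which makes the value of \<open>f\<close> discounted at
rate \<open>1\<close> a supermartingale. Submartingales are covered by passing to \<open>- f\<close>.\<close>

locale drift_bound =
  fixes f f' :: "real \<Rightarrow> real" and A \<theta> \<alpha> :: real
  assumes A_pos: "0 < A" and \<theta>_nonneg: "0 \<le> \<theta>" and \<theta>_less: "\<theta> < 1" and \<alpha>_nonneg: "0 \<le> \<alpha>"
    and f_measurable [measurable]: "f \<in> borel_measurable borel"
    and f'_measurable [measurable]: "f' \<in> borel_measurable borel"
    and f_deriv: "\<And>x. 0 < x \<Longrightarrow> (f has_real_derivative f' x) (at x)"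
    and f'_cont: "continuous_on {0<..} f'"
    and drift: "\<And>y. 0 \<le> y \<Longrightarrow> y \<le> A \<Longrightarrow>
      f' (A - \<theta> * y) * (\<theta> * y) + (A - y) * (f (A - \<theta> * y + \<alpha>) - f (A - \<theta> * y)) \<le> f (A - \<theta> * y)"
begin

text \<open>The derivative of \<open>exp (- s) * f (A - \<theta> * (b * exp (- s)) + \<beta>)\<close>, without its factor \<open>exp (- s)\<close>, as a function
of the current deficit \<open>y = b * exp (- s)\<close>. The shift \<open>\<beta>\<close> is \<open>\<alpha>\<close> after the jump and \<open>0\<close> before it.\<close>

definition rate_of_change :: "real \<Rightarrow> real \<Rightarrow> real" where
  "rate_of_change \<beta> y = f' (A - \<theta> * y + \<beta>) * (\<theta> * y) - f (A - \<theta> * y + \<beta>)"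

definition survival :: "real \<Rightarrow> real \<Rightarrow> real" where
  "survival b s = exp (- (A * s - b * (1 - exp (- s))))"

lemma position_pos: "0 \<le> y \<Longrightarrow> y \<le> A \<Longrightarrow> 0 < A - \<theta> * y"
  using mult_left_mono[OF _ \<theta>_nonneg, of y A] mult_strict_right_mono[OF \<theta>_less A_pos] by simp

lemma f_cont: "continuous_on {0<..} f"
  by (intro continuous_at_imp_continuous_on ballI) (use f_deriv DERIV_isCont in blast)

lemma rate_of_change_measurable [measurable]: "rate_of_change \<beta> \<in> borel_measurable borel"
  unfolding rate_of_change_def[abs_def] by measurable

lemma f_position_cont: "0 \<le> \<beta> \<Longrightarrow> continuous_on {0..A} (\<lambda>y. f (A - \<theta> * y + \<beta>))"
  by (intro continuous_on_compose2[OF f_cont]) (auto intro!: continuous_intros add_pos_nonneg position_pos)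

lemma rate_of_change_cont: "0 \<le> \<beta> \<Longrightarrow> continuous_on {0..A} (rate_of_change \<beta>)"
  unfolding rate_of_change_def[abs_def]
  by (intro continuous_intros f_position_cont continuous_on_compose2[OF f'_cont])
    (auto intro!: continuous_intros add_pos_nonneg position_pos)

lemma f_position_bounded:
  assumes "0 \<le> \<beta>"
  obtains C where "0 \<le> C" "\<And>y. 0 \<le> y \<Longrightarrow> y \<le> A \<Longrightarrow> \<bar>f (A - \<theta> * y + \<beta>)\<bar> \<le> C"
  by (rule continuous_on_compact_bound[OF _ f_position_cont[OF assms]]) auto

lemma rate_of_change_bounded:
  assumes "0 \<le> \<beta>"
  obtains C where "0 \<le> C" "\<And>y. 0 \<le> y \<Longrightarrow> y \<le> A \<Longrightarrow> \<bar>rate_of_change \<beta> y\<bar> \<le> C"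
  by (rule continuous_on_compact_bound[OF _ rate_of_change_cont[OF assms]]) auto

lemma discounted_f_deriv:
  assumes "0 \<le> b" "b \<le> A" "0 \<le> s" "0 \<le> \<beta>"
  shows "((\<lambda>s. exp (- s) * f (A - \<theta> * (b * exp (- s)) + \<beta>)) has_real_derivative
    exp (- s) * rate_of_change \<beta> (b * exp (- s))) (at s)"
proof -
  have y: "0 \<le> b * exp (- s)" "b * exp (- s) \<le> A"
    using assms mult_mono[of b A "exp (- s)" 1] by auto
  have "0 < A - \<theta> * (b * exp (- s)) + \<beta>"
    using position_pos[OF y] assms by simp
  note f_deriv[OF this]
  then have "((\<lambda>s. f (A - \<theta> * (b * exp (- s)) + \<beta>)) has_real_derivative
      f' (A - \<theta> * (b * exp (- s)) + \<beta>) * (\<theta> * (b * exp (- s)))) (at s)"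
    by (rule DERIV_chain2) (auto intro!: derivative_eq_intros)
  then show ?thesis
    unfolding rate_of_change_def
    by (auto intro!: derivative_eq_intros simp: algebra_simps)
qed

lemma decay_in_range: "0 \<le> b \<Longrightarrow> b \<le> A \<Longrightarrow> 0 \<le> s \<Longrightarrow> 0 \<le> b * exp (- s) \<and> b * exp (- s) \<le> A"
  using mult_mono[of b A "exp (- s)" 1] by auto

lemma path_identity:
  assumes b: "0 \<le> b" "b \<le> A" and e: "0 < e"
  shows "exp (- e) * f (A - \<theta> * (b * exp (- e)) + \<alpha>) =
    f (A - \<theta> * b + \<alpha>) + (\<integral>s. indicator {0..<e} s * rate_of_change \<alpha> (b * exp (- s)) \<partial>unit_exponential)"
proof -
  have "(\<integral>s. indicator {0..<e} s * rate_of_change \<alpha> (b * exp (- s)) \<partial>unit_exponential) =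
      (\<integral>s. indicator {..e} s * rate_of_change \<alpha> (b * exp (- s)) \<partial>unit_exponential)"
    using AE_unit_exponential_nonneg AE_unit_exponential_neq[of e]
    by (intro integral_cong_AE) (measurable, auto split: split_indicator)
  also have "\<dots> = exp (- e) * f (A - \<theta> * (b * exp (- e)) + \<alpha>) - exp (- 0) * f (A - \<theta> * (b * exp (- 0)) + \<alpha>)"
    using b e \<alpha>_nonneg
    by (intro integral_unit_exponential_FTC discounted_f_deriv
        continuous_on_compose2[OF rate_of_change_cont])
      (auto intro!: continuous_intros dest: decay_in_range)
  finally show ?thesis by simp
qed

lemma survival_bounds:
  assumes "0 \<le> b" "b \<le> A" "0 \<le> s"
  shows "0 < survival b s" "survival b s \<le> 1"
proof -
  have "1 - exp (- s) \<le> s" using exp_ge_add_one_self[of "- s"] by simp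
  then have "b * (1 - exp (- s)) \<le> A * s" using assms by (intro mult_mono) auto
  then show "0 < survival b s" "survival b s \<le> 1" by (auto simp: survival_def)
qed

lemma survival_measurable [measurable]: "survival b \<in> borel_measurable borel"
  unfolding survival_def[abs_def] by measurable

lemma survival_deriv:
  "(survival b has_real_derivative - ((A - b * exp (- s)) * survival b s)) (at s)"
  unfolding survival_def[abs_def]
  by (auto intro!: derivative_eq_intros simp: algebra_simps)

text \<open>By \<open>path_identity\<close>, the left-hand side is the mean discounted value of \<open>f\<close> just after the jump, when
the waiting time has the given survival function. Let \<open>D s\<close> be the discounted increment of \<open>f\<close> that a
jump at time \<open>s\<close> would bring, times the probability of surviving until \<open>s\<close>. The drift assumption says that
\<open>D\<close> increases at least as fast as the integral on the left. As \<open>D\<close> vanishes at infinity, the integral is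
at most \<open>- D 0\<close>, which is the claim.\<close>

lemma expected_drift:
  assumes b: "0 \<le> b" "b \<le> A"
  shows "f (A - \<theta> * b + \<alpha>) + (\<integral>s. indicator {0..} s * (rate_of_change \<alpha> (b * exp (- s)) * survival b s) \<partial>unit_exponential)
    \<le> f (A - \<theta> * b)"
proof -
  let ?N = unit_exponential
  interpret N: prob_space ?N by (rule prob_space_exponential_density) simp
  define y where "y s = b * exp (- s)" for s
  define k where "k s = rate_of_change \<alpha> (y s) * survival b s" for s
  define jump where "jump s = f (A - \<theta> * y s + \<alpha>) - f (A - \<theta> * y s + 0)" for s
  define m where "m s = (rate_of_change \<alpha> (y s) - rate_of_change 0 (y s) - (A - y s) * jump s) * survival b s" for s
  define D where "D s = exp (- s) * jump s * survival b s" for s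
  note [measurable] = survival_measurable
  have [measurable]: "y \<in> borel_measurable borel" unfolding y_def[abs_def] by measurable
  have [measurable]: "k \<in> borel_measurable borel" "m \<in> borel_measurable borel"
    unfolding k_def[abs_def] m_def[abs_def] jump_def by measurable
  have y: "0 \<le> y s" "y s \<le> A" if "0 \<le> s" for s
    using decay_in_range[OF b that] by (simp_all add: y_def)
  have y_cont: "continuous_on S y" for S unfolding y_def[abs_def] by (intro continuous_intros)
  have D_deriv: "(D has_real_derivative exp (- s) * m s) (at s)" if "0 \<le> s" for s
  proof -
    have "((\<lambda>s. exp (- s) * jump s) has_real_derivative
       exp (- s) * rate_of_change \<alpha> (y s) - exp (- s) * rate_of_change 0 (y s)) (at s)"
      unfolding jump_def y_def right_diff_distrib
      by (intro DERIV_diff discounted_f_deriv b that \<alpha>_nonneg) simp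
    from DERIV_mult[OF this survival_deriv[of b s]] show ?thesis
      unfolding D_def[abs_def] m_def by (simp add: y_def algebra_simps)
  qed
  obtain C1 where C1: "0 \<le> C1" "\<And>y. 0 \<le> y \<Longrightarrow> y \<le> A \<Longrightarrow> \<bar>f (A - \<theta> * y + \<alpha>)\<bar> \<le> C1"
    by (rule f_position_bounded[OF \<alpha>_nonneg]) blast
  obtain C2 where C2: "0 \<le> C2" "\<And>y. 0 \<le> y \<Longrightarrow> y \<le> A \<Longrightarrow> \<bar>f (A - \<theta> * y + 0)\<bar> \<le> C2"
    by (rule f_position_bounded[of 0]) auto
  obtain C3 where C3: "0 \<le> C3" "\<And>y. 0 \<le> y \<Longrightarrow> y \<le> A \<Longrightarrow> \<bar>rate_of_change \<alpha> y\<bar> \<le> C3"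
    by (rule rate_of_change_bounded[OF \<alpha>_nonneg]) blast
  have k_le_m: "k s \<le> m s" if "0 \<le> s" for s
    unfolding k_def m_def
    using drift[OF y[OF that]] survival_bounds[OF b that]
    by (intro mult_right_mono) (auto simp: jump_def rate_of_change_def)
  have D_bound: "\<bar>D s\<bar> \<le> exp (- s) * (C1 + C2)" if "0 \<le> s" for s
  proof -
    have "\<bar>jump s\<bar> \<le> C1 + C2" unfolding jump_def using C1(2)[OF y[OF that]] C2(2)[OF y[OF that]] by linarith
    then have "\<bar>D s\<bar> \<le> exp (- s) * (C1 + C2) * 1"
      unfolding D_def abs_mult using survival_bounds[OF b that] C1(1) C2(1)
      by (intro mult_mono) auto
    then show ?thesis by simp
  qed
  have k_int: "integrable ?N (\<lambda>s. indicator {0..} s * k s)"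
  proof (rule N.integrable_const_bound[where B = C3])
    have "\<bar>k s\<bar> \<le> C3 * 1" if "0 \<le> s" for s
      unfolding k_def abs_mult using C3 y[OF that] survival_bounds[OF b that] by (intro mult_mono) auto
    then show "AE s in ?N. norm (indicator {0..} s * k s) \<le> C3"
      using C3(1) by (auto split: split_indicator)
  qed measurable
  have partial: "(\<integral>s. indicator {..t} s *\<^sub>R (indicator {0..} s * k s) \<partial>?N) \<le> D t - D 0" if t: "0 \<le> t" for t
  proof -
    have "continuous_on {0..t} (\<lambda>s. rate_of_change \<beta> (y s))" if "0 \<le> \<beta>" for \<beta>
      using that y by (intro continuous_on_compose2[OF rate_of_change_cont y_cont]) auto
    moreover have "continuous_on {0..t} (\<lambda>s. f (A - \<theta> * y s + \<beta>))" if "0 \<le> \<beta>" for \<beta>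
      using that y by (intro continuous_on_compose2[OF f_position_cont y_cont]) auto
    moreover have "continuous_on {0..t} (survival b)"
      unfolding survival_def[abs_def] by (intro continuous_intros)
    ultimately have m_cont: "continuous_on {0..t} m"
      unfolding m_def[abs_def] jump_def using \<alpha>_nonneg
      by (intro continuous_intros y_cont) (auto simp del: add_0_right)
    obtain C where C: "0 \<le> C" "\<And>s. s \<in> {0..t} \<Longrightarrow> norm (m s) \<le> C"
      using continuous_on_compact_bound[OF compact_Icc m_cont] by blast
    \<comment> \<open>\<open>m\<close> is the derivative of \<open>D\<close> without the discount, so its integral is \<open>D t - D 0\<close>.\<close>
    have "(\<integral>s. indicator {..t} s *\<^sub>R (indicator {0..} s * k s) \<partial>?N) \<le> (\<integral>s. indicator {..t} s * m s \<partial>?N)"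
    proof (rule integral_mono_AE)
      show "integrable ?N (\<lambda>s. indicator {..t} s *\<^sub>R (indicator {0..} s * k s))"
        using k_int by (rule integrable_mult_indicator[rotated]) simp
      show "integrable ?N (\<lambda>s. indicator {..t} s * m s)"
      proof (rule N.integrable_const_bound[where B = C])
        show "AE s in ?N. norm (indicator {..t} s * m s) \<le> C"
          using AE_unit_exponential_nonneg by eventually_elim (use C in \<open>auto split: split_indicator\<close>)
      qed measurable
      show "AE s in ?N. indicator {..t} s *\<^sub>R (indicator {0..} s * k s) \<le> indicator {..t} s * m s"
        using AE_unit_exponential_nonneg by eventually_elim (use k_le_m in \<open>auto split: split_indicator\<close>)
    qed
    also have "\<dots> = D t - D 0"
      by (rule integral_unit_exponential_FTC) (use t m_cont D_deriv in auto)
    finally show ?thesis .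
  qed
  have "(\<integral>s. indicator {0..} s * k s \<partial>?N) \<le> 0 - D 0"
  proof (rule tendsto_le[OF _ _ tendsto_integral_at_top[OF _ k_int]])
    have "((\<lambda>s. exp (- s) * (C1 + C2)) \<longlongrightarrow> 0) at_top"
      by (intro tendsto_mult_left_zero filterlim_compose[OF exp_at_bot] filterlim_uminus_at_bot_at_top)
    then have "(D \<longlongrightarrow> 0) at_top"
      by (rule Lim_null_comparison[rotated]) (auto intro!: eventually_at_top_linorderI[of 0] D_bound)
    then show "((\<lambda>t. D t - D 0) \<longlongrightarrow> 0 - D 0) at_top" by (intro tendsto_intros)
    show "\<forall>\<^sub>F t in at_top. (\<integral>s. indicator {..t} s *\<^sub>R (indicator {0..} s * k s) \<partial>?N) \<le> D t - D 0"
      by (rule eventually_at_top_linorderI[of 0]) (rule partial)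
  qed auto
  moreover have "D 0 = f (A - \<theta> * b + \<alpha>) - f (A - \<theta> * b)"
    by (simp add: D_def jump_def y_def survival_def)
  ultimately show ?thesis by (simp add: k_def y_def)
qed

text \<open>The factor \<open>G\<close> carries the discount accumulated in the past and \<open>B\<close> the deficit at the start of the
waiting time \<open>E\<close>. Only the conditional probabilities of the events \<open>s < E\<close> are given, one null set for
each \<open>s\<close>. The path identity expresses the value at time \<open>E\<close> as an integral over \<open>s\<close> of past-measurable
functions times the indicators of these events, so after exchanging the integrals each \<open>s\<close> can be
treated on its own.\<close>

lemma conditional_drift:
  fixes M F :: "'a measure" and E B G :: "'a \<Rightarrow> real"
  assumes prob: "prob_space M" and sub: "subalgebra M F"
    and E_meas [measurable]: "E \<in> borel_measurable M" and E_pos: "AE \<omega> in M. 0 < E \<omega>"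
    and B_meas: "B \<in> borel_measurable F" and B: "\<And>\<omega>. 0 \<le> B \<omega>" "\<And>\<omega>. B \<omega> \<le> A"
    and G_meas: "G \<in> borel_measurable F" and G: "\<And>\<omega>. 0 \<le> G \<omega>" "\<And>\<omega>. G \<omega> \<le> 1"
    and cond: "\<And>s. 0 \<le> s \<Longrightarrow> AE \<omega> in M.
      real_cond_exp M F (indicator {\<omega> \<in> space M. s < E \<omega>}) \<omega> = survival (B \<omega>) s"
  shows "(\<integral>\<omega>. G \<omega> * (exp (- E \<omega>) * f (A - \<theta> * (B \<omega> * exp (- E \<omega>)) + \<alpha>)) \<partial>M)
    \<le> (\<integral>\<omega>. G \<omega> * f (A - \<theta> * B \<omega>) \<partial>M)"
proof -
  let ?N = unit_exponential
  interpret prob_space M by fact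
  interpret F: finite_measure_subalgebra M F by standard fact
  interpret N: prob_space ?N by (rule prob_space_exponential_density) simp
  interpret MN: pair_prob_space M ?N ..
  have [measurable]: "B \<in> borel_measurable M" "G \<in> borel_measurable M"
    using measurable_from_subalg[OF sub B_meas] measurable_from_subalg[OF sub G_meas] by auto
  note [measurable] = B_meas G_meas
  define k where "k \<omega> s = rate_of_change \<alpha> (B \<omega> * exp (- s))" for \<omega> s
  obtain C0 where C0: "0 \<le> C0" "\<And>y. 0 \<le> y \<Longrightarrow> y \<le> A \<Longrightarrow> \<bar>f (A - \<theta> * y + 0)\<bar> \<le> C0"
    by (rule f_position_bounded[of 0]) auto
  obtain C1 where C1: "0 \<le> C1" "\<And>y. 0 \<le> y \<Longrightarrow> y \<le> A \<Longrightarrow> \<bar>f (A - \<theta> * y + \<alpha>)\<bar> \<le> C1"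
    by (rule f_position_bounded[OF \<alpha>_nonneg]) blast
  obtain C where C: "0 \<le> C" "\<And>y. 0 \<le> y \<Longrightarrow> y \<le> A \<Longrightarrow> \<bar>rate_of_change \<alpha> y\<bar> \<le> C"
    by (rule rate_of_change_bounded[OF \<alpha>_nonneg]) blast
  have k_bound: "\<bar>k \<omega> s\<bar> \<le> C" if "0 \<le> s" for \<omega> s
    unfolding k_def using decay_in_range[OF B(1,2) that] C(2) by simp
  have G_mult: "\<bar>G \<omega> * z\<bar> \<le> c" if "\<bar>z\<bar> \<le> c" for \<omega> z c
    using mult_mono[OF G(2) that] G(1)[of \<omega>] by (simp add: abs_mult)
  define P where "P \<omega> s = G \<omega> * (indicator {0..<E \<omega>} s * k \<omega> s)" for \<omega> s
  define Q where "Q \<omega> s = G \<omega> * (indicator {0..} s * (k \<omega> s * survival (B \<omega>) s))" for \<omega> s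
  have P_eq: "P \<omega> s = indicator {0..} s * (G \<omega> * k \<omega> s * (if s < E \<omega> then 1 else 0))" for \<omega> s
    by (auto simp: P_def split: split_indicator)
  have P_int: "integrable (M \<Otimes>\<^sub>M ?N) (case_prod P)"
  proof (rule MN.P.integrable_const_bound[where B = C])
    show "AE x in M \<Otimes>\<^sub>M ?N. norm (case_prod P x) \<le> C"
      using C(1) k_bound by (intro AE_I2) (auto simp: P_def intro!: G_mult split: split_indicator)
    show "case_prod P \<in> borel_measurable (M \<Otimes>\<^sub>M ?N)"
      unfolding P_eq k_def by measurable
  qed
  have Q_int: "integrable (M \<Otimes>\<^sub>M ?N) (case_prod Q)"
  proof (rule MN.P.integrable_const_bound[where B = C])
    have "\<bar>k \<omega> s * survival (B \<omega>) s\<bar> \<le> C * 1" if "0 \<le> s" for \<omega> s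
      unfolding abs_mult using survival_bounds[OF B that] k_bound[OF that] C(1) by (intro mult_mono) (auto simp: abs_of_pos less_imp_le)
    then show "AE x in M \<Otimes>\<^sub>M ?N. norm (case_prod Q x) \<le> C"
      using C(1) by (intro AE_I2) (auto simp: Q_def intro!: G_mult split: split_indicator)
    show "case_prod Q \<in> borel_measurable (M \<Otimes>\<^sub>M ?N)"
      unfolding Q_def k_def survival_def by measurable
  qed
  \<comment> \<open>For fixed \<open>s\<close> the indicator of \<open>s < E\<close> may be replaced by its conditional probability.\<close>
  have slice: "(\<integral>\<omega>. P \<omega> s \<partial>M) = (\<integral>\<omega>. Q \<omega> s \<partial>M)" if s: "0 \<le> s" for s
  proof -
    let ?g = "\<lambda>\<omega>. G \<omega> * k \<omega> s" and ?i = "indicator {\<omega> \<in> space M. s < E \<omega>} :: 'a \<Rightarrow> real"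
    have k_meas: "(\<lambda>\<omega>. k \<omega> s) \<in> borel_measurable F" unfolding k_def by measurable
    then have [measurable]: "?g \<in> borel_measurable F" by measurable
    have [measurable]: "?g \<in> borel_measurable M" by (rule measurable_from_subalg[OF sub]) measurable
    have "integrable M (\<lambda>\<omega>. ?g \<omega> * ?i \<omega>)"
      using C(1) by (intro integrable_const_bound[where B = C])
        (auto intro!: G_mult k_bound s split: split_indicator)
    note int = F.real_cond_exp_intg(2)[OF this]
    have "(\<integral>\<omega>. P \<omega> s \<partial>M) = (\<integral>\<omega>. ?g \<omega> * ?i \<omega> \<partial>M)"
      using s by (intro Bochner_Integration.integral_cong refl) (auto simp: P_def split: split_indicator)
    also have "\<dots> = (\<integral>\<omega>. ?g \<omega> * real_cond_exp M F ?i \<omega> \<partial>M)"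
      by (rule int[symmetric]) measurable
    also have "\<dots> = (\<integral>\<omega>. Q \<omega> s \<partial>M)"
    proof (rule integral_cong_AE)
      show "AE \<omega> in M. ?g \<omega> * real_cond_exp M F ?i \<omega> = Q \<omega> s"
        using cond[OF s] by eventually_elim (simp add: Q_def s)
      show "(\<lambda>\<omega>. Q \<omega> s) \<in> borel_measurable M" unfolding Q_def k_def survival_def by measurable
    qed measurable
    finally show ?thesis .
  qed
  have start_int: "integrable M (\<lambda>\<omega>. G \<omega> * f (A - \<theta> * B \<omega> + \<alpha>))"
    using B C1 by (intro integrable_const_bound[where B = C1]) (auto intro!: G_mult)
  have "(\<integral>\<omega>. G \<omega> * (exp (- E \<omega>) * f (A - \<theta> * (B \<omega> * exp (- E \<omega>)) + \<alpha>)) \<partial>M) =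
     (\<integral>\<omega>. G \<omega> * f (A - \<theta> * B \<omega> + \<alpha>) + (\<integral>s. P \<omega> s \<partial>?N) \<partial>M)"
  proof (rule integral_cong_AE)
    show "AE \<omega> in M. G \<omega> * (exp (- E \<omega>) * f (A - \<theta> * (B \<omega> * exp (- E \<omega>)) + \<alpha>)) =
      G \<omega> * f (A - \<theta> * B \<omega> + \<alpha>) + (\<integral>s. P \<omega> s \<partial>?N)"
      using E_pos by eventually_elim (simp add: path_identity[OF B] P_def k_def distrib_left)
    show "(\<lambda>\<omega>. G \<omega> * f (A - \<theta> * B \<omega> + \<alpha>) + (\<integral>s. P \<omega> s \<partial>?N)) \<in> borel_measurable M"
      using MN.integrable_fst'[OF P_int] by (intro borel_measurable_add) (auto simp: borel_measurable_integrable)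
  qed measurable
  also have "\<dots> = (\<integral>\<omega>. G \<omega> * f (A - \<theta> * B \<omega> + \<alpha>) \<partial>M) + (\<integral>\<omega>. (\<integral>s. P \<omega> s \<partial>?N) \<partial>M)"
    using MN.integrable_fst'[OF P_int] start_int by simp
  also have "(\<integral>\<omega>. (\<integral>s. P \<omega> s \<partial>?N) \<partial>M) = (\<integral>s. (\<integral>\<omega>. P \<omega> s \<partial>M) \<partial>?N)"
    by (rule MN.Fubini_integral[symmetric, OF P_int])
  also have "\<dots> = (\<integral>s. (\<integral>\<omega>. Q \<omega> s \<partial>M) \<partial>?N)"
  proof (rule integral_cong_AE)
    show "AE s in ?N. (\<integral>\<omega>. P \<omega> s \<partial>M) = (\<integral>\<omega>. Q \<omega> s \<partial>M)"
      using AE_unit_exponential_nonneg by eventually_elim (rule slice)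
    show "(\<lambda>s. \<integral>\<omega>. P \<omega> s \<partial>M) \<in> borel_measurable ?N" "(\<lambda>s. \<integral>\<omega>. Q \<omega> s \<partial>M) \<in> borel_measurable ?N"
      using MN.integrable_snd[OF P_int] MN.integrable_snd[OF Q_int] by (auto simp: borel_measurable_integrable)
  qed
  also have "\<dots> = (\<integral>\<omega>. (\<integral>s. Q \<omega> s \<partial>?N) \<partial>M)"
    by (rule MN.Fubini_integral[OF Q_int])
  also have "(\<integral>\<omega>. G \<omega> * f (A - \<theta> * B \<omega> + \<alpha>) \<partial>M) + \<dots> =
      (\<integral>\<omega>. G \<omega> * f (A - \<theta> * B \<omega> + \<alpha>) + (\<integral>s. Q \<omega> s \<partial>?N) \<partial>M)"
    using MN.integrable_fst'[OF Q_int] start_int by simp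
  also have "\<dots> \<le> (\<integral>\<omega>. G \<omega> * f (A - \<theta> * B \<omega>) \<partial>M)"
  proof (rule integral_mono)
    show "integrable M (\<lambda>\<omega>. G \<omega> * f (A - \<theta> * B \<omega> + \<alpha>) + (\<integral>s. Q \<omega> s \<partial>?N))"
      using MN.integrable_fst'[OF Q_int] start_int by simp
    show "integrable M (\<lambda>\<omega>. G \<omega> * f (A - \<theta> * B \<omega>))"
      using B C0 by (intro integrable_const_bound[where B = C0]) (auto intro!: G_mult)
    show "G \<omega> * f (A - \<theta> * B \<omega> + \<alpha>) + (\<integral>s. Q \<omega> s \<partial>?N) \<le> G \<omega> * f (A - \<theta> * B \<omega>)" for \<omega>
      using mult_left_mono[OF expected_drift[OF B(1,2)[of \<omega>]] G(1)[of \<omega>]]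
      by (simp add: Q_def k_def distrib_left)
  qed
  finally show ?thesis .
qed

end

section \<open>The weight of the point process\<close>

definition initial_rate :: "real \<Rightarrow> real" where
  "initial_rate \<delta> = (1 + \<delta>) / (1 + \<delta> / 2)"

definition point_rate :: "real \<Rightarrow> real" where
  "point_rate \<delta> = 1 / (1 + \<delta> / 2)"

text \<open>The intensity after \<open>n\<close> points if time \<open>0\<close> and all of them lay infinitely far back.\<close>

definition max_rate :: "real \<Rightarrow> nat \<Rightarrow> real" where
  "max_rate \<delta> n = initial_rate \<delta> + point_rate \<delta> * real n"

text \<open>The shortfall from \<open>max_rate\<close> immediately after the \<open>n\<close>-th point, when that point itself contributes
nothing yet. After a further time \<open>t\<close> without points it has decayed by the factor \<open>exp (- t)\<close>.\<close>

definition deficit :: "real \<Rightarrow> nat \<Rightarrow> (nat \<Rightarrow> real) \<Rightarrow> real" where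
  "deficit \<delta> n s =
    initial_rate \<delta> * exp (- s n) + point_rate \<delta> * (\<Sum>j=1..n. exp (- (s n - s j)))"

text \<open>The linear combination of \<open>max_rate\<close> and \<open>deficit\<close> that grows, in the mean, proportionally to itself.\<close>

definition weight :: "real \<Rightarrow> nat \<Rightarrow> (nat \<Rightarrow> real) \<Rightarrow> real" where
  "weight \<delta> n s = max_rate \<delta> n - 1 / (tail_exponent \<delta> + 1) * deficit \<delta> n s"

lemma rates_pos:
  assumes "\<delta> > -1"
  shows "0 < initial_rate \<delta>" "0 < point_rate \<delta>"
  using assms by (auto simp: initial_rate_def point_rate_def)

lemma max_rate_pos: "\<delta> > -1 \<Longrightarrow> 0 < max_rate \<delta> n"
  using rates_pos[of \<delta>] by (auto simp: max_rate_def intro!: add_pos_nonneg)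

text \<open>At a point the maximal rate and the deficit both jump by \<open>point_rate \<delta>\<close>. The weight therefore jumps by the
left-hand side, which the quadratic equation for the exponent turns into \<open>1 / tail_exponent \<delta>\<close>.\<close>

lemma weight_increment:
  assumes "\<delta> > -1"
  shows "point_rate \<delta> - 1 / (tail_exponent \<delta> + 1) * point_rate \<delta> = 1 / tail_exponent \<delta>"
proof -
  define u where "u = 1 + \<delta> / 2"
  define p where "p = tail_exponent \<delta>"
  have u: "0 < u" using assms by (simp add: u_def)
  have p: "1 < p" unfolding p_def by (rule tail_exponent_gt_1[OF assms])
  have "p * p = u * (p + 1)"
    using tail_exponent_quadratic[OF assms] by (simp add: p_def u_def power2_eq_square)
  then have "u = p * p / (p + 1)" using p by (simp add: eq_divide_eq)
  then have inv: "1 / u = (p + 1) / (p * p)" by (metis divide_divide_eq_right mult_1)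
  have "1 / (p + 1) * ((p + 1) / (p * p)) = 1 / (p * p)" using p by simp
  then have "1 / u - 1 / (p + 1) * (1 / u) = (p + 1) / (p * p) - 1 / (p * p)"
    unfolding inv by (simp only:)
  also have "\<dots> = 1 / p" using p unfolding diff_divide_distrib[symmetric] by simp
  finally have "1 / u - 1 / (p + 1) * (1 / u) = 1 / p" .
  then show ?thesis by (simp add: point_rate_def u_def p_def)
qed

lemma deficit_Suc:
  "deficit \<delta> (Suc n) s = deficit \<delta> n s * exp (- (s (Suc n) - s n)) + point_rate \<delta>"
proof -
  define r where "r = exp (- (s (Suc n) - s n))"
  have "exp (- s (Suc n)) = exp (- s n) * r" by (simp add: r_def flip: exp_add)
  moreover have "(\<Sum>j=1..Suc n. exp (- (s (Suc n) - s j))) = (\<Sum>j=1..n. exp (- (s n - s j))) * r + 1"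
  proof -
    have "(\<Sum>j=1..n. exp (- (s (Suc n) - s j))) = (\<Sum>j=1..n. exp (- (s n - s j)) * r)"
      by (simp add: r_def flip: exp_add)
    then show ?thesis unfolding sum_distrib_right by simp
  qed
  ultimately show ?thesis
    unfolding deficit_def r_def[symmetric] by (simp only: distrib_left distrib_right mult.assoc)
qed

lemma weight_Suc:
  assumes "\<delta> > -1"
  shows "weight \<delta> (Suc n) s = max_rate \<delta> n -
    1 / (tail_exponent \<delta> + 1) * (deficit \<delta> n s * exp (- (s (Suc n) - s n))) + 1 / tail_exponent \<delta>"
  unfolding weight_def deficit_Suc weight_increment[OF assms, symmetric]
  by (simp add: max_rate_def algebra_simps)

lemma drift_bound_powr:
  fixes \<delta> :: real and n :: nat
  defines "b \<equiv> 1 + (tail_exponent \<delta> - 1) * exp (tail_exponent \<delta> - 1)"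
  assumes "\<delta> > -1"
  shows "drift_bound (\<lambda>x. (x + b) powr tail_exponent \<delta>)
    (\<lambda>x. tail_exponent \<delta> * (x + b) powr (tail_exponent \<delta> - 1))
    (max_rate \<delta> n) (1 / (tail_exponent \<delta> + 1)) (1 / tail_exponent \<delta>)"
proof -
  define p where "p = tail_exponent \<delta>"
  have p: "1 < p" unfolding p_def by (rule tail_exponent_gt_1) fact
  have b: "b = 1 + (p - 1) * exp (p - 1)" by (simp add: b_def p_def)
  then have "0 < b" using p by (auto intro!: add_pos_nonneg)
  show ?thesis
    unfolding p_def[symmetric]
  proof
    fix y assume y: "0 \<le> y" "y \<le> max_rate \<delta> n"
    show "p * (max_rate \<delta> n - 1 / (p + 1) * y + b) powr (p - 1) * (1 / (p + 1) * y) +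
      (max_rate \<delta> n - y) * ((max_rate \<delta> n - 1 / (p + 1) * y + 1 / p + b) powr p -
        (max_rate \<delta> n - 1 / (p + 1) * y + b) powr p)
      \<le> (max_rate \<delta> n - 1 / (p + 1) * y + b) powr p"
      using powr_drift_le[OF p y max_rate_pos[OF assms(2)]] unfolding b by (simp add: add_ac)
  qed (use p max_rate_pos[OF assms(2)] \<open>0 < b\<close> in \<open>auto intro!: derivative_eq_intros continuous_intros simp: powr_diff\<close>)
qed

lemma drift_bound_minus_powr:
  fixes \<delta> :: real and n :: nat
  assumes "\<delta> > -1"
  shows "drift_bound (\<lambda>x. - (x powr tail_exponent \<delta>))
    (\<lambda>x. - (tail_exponent \<delta> * x powr (tail_exponent \<delta> - 1)))
    (max_rate \<delta> n) (1 / (tail_exponent \<delta> + 1)) (1 / tail_exponent \<delta>)"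
proof -
  define p where "p = tail_exponent \<delta>"
  have p: "1 < p" unfolding p_def by (rule tail_exponent_gt_1) fact
  show ?thesis
    unfolding p_def[symmetric]
  proof
    fix y assume y: "0 \<le> y" "y \<le> max_rate \<delta> n"
    show "- (p * (max_rate \<delta> n - 1 / (p + 1) * y) powr (p - 1)) * (1 / (p + 1) * y) +
      (max_rate \<delta> n - y) * (- ((max_rate \<delta> n - 1 / (p + 1) * y + 1 / p) powr p) -
        - ((max_rate \<delta> n - 1 / (p + 1) * y) powr p))
      \<le> - ((max_rate \<delta> n - 1 / (p + 1) * y) powr p)"
      using powr_drift_ge[OF p y max_rate_pos[OF assms]] by (simp add: algebra_simps)
  qed (use p max_rate_pos[OF assms] in \<open>auto intro!: derivative_eq_intros continuous_intros simp: powr_diff\<close>)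
qed

text \<open>A point of finite age contributes less to the intensity than one of infinite age.\<close>

lemma deficit_le_max_rate:
  assumes "\<delta> > -1" and mono: "\<And>j. j \<le> n \<Longrightarrow> s j \<le> s n" and "0 \<le> s n"
  shows "0 \<le> deficit \<delta> n s" "deficit \<delta> n s \<le> max_rate \<delta> n"
proof -
  note c = rates_pos[OF assms(1)]
  show "0 \<le> deficit \<delta> n s"
    unfolding deficit_def using c by (intro add_nonneg_nonneg mult_nonneg_nonneg sum_nonneg) auto
  have "(\<Sum>j=1..n. exp (- (s n - s j))) \<le> (\<Sum>j=1..n. 1)"
    using mono by (intro sum_mono) auto
  then show "deficit \<delta> n s \<le> max_rate \<delta> n"
    unfolding deficit_def max_rate_def using c \<open>0 \<le> s n\<close>
    by (intro add_mono mult_left_mono) (auto simp: mult_left_le)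
qed

lemma max_rate_bounds:
  assumes "\<delta> > -1"
  shows "min (initial_rate \<delta>) (point_rate \<delta>) * real (Suc n) \<le> max_rate \<delta> n"
    and "max_rate \<delta> n \<le> max (initial_rate \<delta>) (point_rate \<delta>) * real (Suc n)"
proof -
  let ?m = "min (initial_rate \<delta>) (point_rate \<delta>)" and ?w = "max (initial_rate \<delta>) (point_rate \<delta>)"
  have "?m * real n \<le> point_rate \<delta> * real n" "point_rate \<delta> * real n \<le> ?w * real n"
    by (intro mult_right_mono; simp)+
  then show "?m * real (Suc n) \<le> max_rate \<delta> n" "max_rate \<delta> n \<le> ?w * real (Suc n)"
    unfolding max_rate_def of_nat_Suc distrib_left by linarith+
qed

context self_reinforced_model
begin

lemma partial_sum_measurable [measurable]: "partial_sum E n \<in> borel_measurable M"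
  unfolding partial_sum_def[abs_def] by (intro borel_measurable_sum E_measurable) auto

lemma subalgebra_past: "subalgebra M (past M E k)"
proof -
  have "(\<lambda>\<omega>. \<lambda>j\<in>{1..<k}. partial_sum E j \<omega>) \<in> measurable M (\<Pi>\<^sub>M j\<in>{1..<k}. borel)"
    by (intro measurable_restrict partial_sum_measurable)
  then show ?thesis
    unfolding subalgebra_def past_def by (auto simp: sets_vimage_algebra2 space_PiM measurable_sets)
qed

lemma partial_sum_past:
  assumes "j \<le> n"
  shows "partial_sum E j \<in> borel_measurable (past M E (Suc n))"
proof (cases "j = 0")
  case True
  then show ?thesis by (simp add: partial_sum_def[abs_def])
next
  case False
  let ?V = "\<lambda>\<omega>. \<lambda>j\<in>{1..<Suc n}. partial_sum E j \<omega>"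
  have j: "j \<in> {1..<Suc n}" using assms False by auto
  have "?V \<in> measurable (past M E (Suc n)) (\<Pi>\<^sub>M j\<in>{1..<Suc n}. borel)"
    unfolding past_def by (rule measurable_vimage_algebra1) (auto simp: space_PiM)
  from measurable_compose[OF this measurable_component_singleton[OF j]]
  show ?thesis using j by simp
qed

lemma deficit_past:
  "(\<lambda>\<omega>. deficit \<delta> n (\<lambda>j. partial_sum E j \<omega>)) \<in> borel_measurable (past M E (Suc n))"
proof -
  note [measurable] = partial_sum_past[of n n]
  have "(\<lambda>\<omega>. exp (- (partial_sum E n \<omega> - partial_sum E j \<omega>))) \<in> borel_measurable (past M E (Suc n))"
    if "j \<in> {1..n}" for j
  proof -
    have [measurable]: "partial_sum E j \<in> borel_measurable (past M E (Suc n))"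
      using that by (intro partial_sum_past) auto
    show ?thesis by measurable
  qed
  then show ?thesis
    unfolding deficit_def
    by (intro borel_measurable_add borel_measurable_times borel_measurable_sum) auto
qed

lemma weight_measurable [measurable]:
  "(\<lambda>\<omega>. weight \<delta> n (\<lambda>j. partial_sum E j \<omega>)) \<in> borel_measurable M"
  using measurable_from_subalg[OF subalgebra_past deficit_past[of n]]
  unfolding weight_def by measurable

lemma AE_partial_sum_mono: "AE \<omega> in M. \<forall>n. \<forall>j\<le>n. partial_sum E j \<omega> \<le> partial_sum E n \<omega>"
proof -
  have "AE \<omega> in M. \<forall>k. 1 \<le> k \<longrightarrow> 0 < E k \<omega>"
    using E_pos by (auto simp: AE_all_countable)
  then show ?thesis
  proof eventually_elim
    case (elim \<omega>)
    show ?case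
      unfolding partial_sum_def
      by (intro allI impI sum_mono2) (use elim in \<open>auto intro: less_imp_le\<close>)
  qed
qed

lemma AE_partial_sum_nonneg: "AE \<omega> in M. 0 \<le> partial_sum E n \<omega>"
  using AE_partial_sum_mono
proof eventually_elim
  case (elim \<omega>)
  then have "partial_sum E 0 \<omega> \<le> partial_sum E n \<omega>" by blast
  then show ?case by (simp add: partial_sum_def)
qed

lemma AE_deficit_bounds:
  assumes "\<delta> > -1"
  shows "AE \<omega> in M. 0 \<le> partial_sum E n \<omega> \<and> 0 \<le> deficit \<delta> n (\<lambda>j. partial_sum E j \<omega>) \<and>
    deficit \<delta> n (\<lambda>j. partial_sum E j \<omega>) \<le> max_rate \<delta> n"
  using AE_partial_sum_mono AE_partial_sum_nonneg[of n]
proof eventually_elim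
  case (elim \<omega>)
  then show ?case using deficit_le_max_rate[OF assms, of n "\<lambda>j. partial_sum E j \<omega>"] elim by auto
qed

text \<open>Weight, maximal rate and, by \<open>max_rate_bounds\<close>, the number of points are comparable up to constants.\<close>

lemma AE_weight_bounds:
  assumes "\<delta> > -1"
  shows "AE \<omega> in M. tail_exponent \<delta> / (tail_exponent \<delta> + 1) * max_rate \<delta> n \<le> weight \<delta> n (\<lambda>j. partial_sum E j \<omega>)
    \<and> weight \<delta> n (\<lambda>j. partial_sum E j \<omega>) \<le> max_rate \<delta> n \<and> 0 \<le> partial_sum E n \<omega>"
  using AE_deficit_bounds[OF assms, of n]
proof eventually_elim
  case (elim \<omega>)
  define p where "p = tail_exponent \<delta>"
  have p: "1 < p" unfolding p_def by (rule tail_exponent_gt_1[OF assms])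
  have "0 \<le> 1 / (p + 1) * deficit \<delta> n (\<lambda>j. partial_sum E j \<omega>)"
    "1 / (p + 1) * deficit \<delta> n (\<lambda>j. partial_sum E j \<omega>) \<le> 1 / (p + 1) * max_rate \<delta> n"
    using elim p by (intro mult_nonneg_nonneg mult_left_mono; simp)+
  moreover have "p / (p + 1) * max_rate \<delta> n = max_rate \<delta> n - 1 / (p + 1) * max_rate \<delta> n"
    using p by (simp add: field_simps)
  ultimately show ?case using elim unfolding weight_def p_def[symmetric] by linarith
qed

text \<open>The deficit and the discount satisfy the bounds of \<open>conditional_drift\<close> only almost surely. They are
clamped to the required ranges, which keeps them measurable with respect to the past.\<close>

lemma discounted_weight_step:
  assumes \<delta>: "\<delta> > -1"
    and drift: "drift_bound f f' (max_rate \<delta> n) (1 / (tail_exponent \<delta> + 1)) (1 / tail_exponent \<delta>)"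
  shows "(\<integral>\<omega>. exp (- partial_sum E (Suc n) \<omega>) * f (weight \<delta> (Suc n) (\<lambda>j. partial_sum E j \<omega>)) \<partial>M)
    \<le> (\<integral>\<omega>. exp (- partial_sum E n \<omega>) * f (weight \<delta> n (\<lambda>j. partial_sum E j \<omega>)) \<partial>M)"
proof -
  interpret drift_bound f f' "max_rate \<delta> n" "1 / (tail_exponent \<delta> + 1)" "1 / tail_exponent \<delta>" by fact
  define D where "D \<omega> = deficit \<delta> n (\<lambda>j. partial_sum E j \<omega>)" for \<omega>
  define B where "B \<omega> = max 0 (min (D \<omega>) (max_rate \<delta> n))" for \<omega>
  define G where "G \<omega> = min (exp (- partial_sum E n \<omega>)) 1" for \<omega>
  note [measurable] = deficit_past[of n] partial_sum_past[of n n]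
  have E_meas [measurable]: "E (Suc n) \<in> borel_measurable M" by (rule E_measurable) simp
  have B_past [measurable]: "B \<in> borel_measurable (past M E (Suc n))" unfolding B_def[abs_def] D_def by measurable
  have G_past [measurable]: "G \<in> borel_measurable (past M E (Suc n))" unfolding G_def[abs_def] by measurable
  have [measurable]: "B \<in> borel_measurable M" "G \<in> borel_measurable M"
    by (rule measurable_from_subalg[OF subalgebra_past B_past] measurable_from_subalg[OF subalgebra_past G_past])+
  have clamp: "AE \<omega> in M. B \<omega> = D \<omega> \<and> G \<omega> = exp (- partial_sum E n \<omega>)"
    using AE_deficit_bounds[OF \<delta>, of n] by eventually_elim (auto simp: B_def G_def D_def)
  have "(\<integral>\<omega>. exp (- partial_sum E (Suc n) \<omega>) * f (weight \<delta> (Suc n) (\<lambda>j. partial_sum E j \<omega>)) \<partial>M) =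
    (\<integral>\<omega>. G \<omega> * (exp (- E (Suc n) \<omega>) * f (max_rate \<delta> n - 1 / (tail_exponent \<delta> + 1) *
       (B \<omega> * exp (- E (Suc n) \<omega>)) + 1 / tail_exponent \<delta>)) \<partial>M)"
  proof (rule integral_cong_AE)
    show "AE \<omega> in M. exp (- partial_sum E (Suc n) \<omega>) * f (weight \<delta> (Suc n) (\<lambda>j. partial_sum E j \<omega>)) =
      G \<omega> * (exp (- E (Suc n) \<omega>) * f (max_rate \<delta> n - 1 / (tail_exponent \<delta> + 1) *
       (B \<omega> * exp (- E (Suc n) \<omega>)) + 1 / tail_exponent \<delta>))"
      using clamp
    proof eventually_elim
      case (elim \<omega>)
      have s: "partial_sum E (Suc n) \<omega> = partial_sum E n \<omega> + E (Suc n) \<omega>"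
        by (simp add: partial_sum_def)
      have w: "weight \<delta> (Suc n) (\<lambda>j. partial_sum E j \<omega>) = max_rate \<delta> n - 1 / (tail_exponent \<delta> + 1) *
        (B \<omega> * exp (- E (Suc n) \<omega>)) + 1 / tail_exponent \<delta>"
        unfolding weight_Suc[OF \<delta>] s using elim by (simp add: D_def)
      show ?case unfolding w unfolding s using elim by (simp add: exp_add exp_diff exp_minus field_simps)
    qed
  qed measurable
  also have "\<dots> \<le> (\<integral>\<omega>. G \<omega> * f (max_rate \<delta> n - 1 / (tail_exponent \<delta> + 1) * B \<omega>) \<partial>M)"
  proof (rule conditional_drift[OF prob_space_axioms subalgebra_past])
    show "AE \<omega> in M. 0 < E (Suc n) \<omega>" by (rule E_pos) simp
    show "AE \<omega> in M. real_cond_exp M (past M E (Suc n)) (indicator {\<omega> \<in> space M. s < E (Suc n) \<omega>}) \<omega> =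
      survival (B \<omega>) s" if s: "0 \<le> s" for s
      using E_hazard[of "Suc n" s, OF _ s, simplified] clamp
    proof eventually_elim
      case (elim \<omega>)
      have "(LBINT x:{0..s}. hazard \<delta> (Suc n) (\<lambda>j. partial_sum E j \<omega>) x) =
          max_rate \<delta> n * s - D \<omega> * (1 - exp (- s))"
        unfolding set_integral_hazard[OF s] D_def
        by (simp add: max_rate_def deficit_def initial_rate_def point_rate_def)
      then show ?case using elim by (simp add: survival_def)
    qed
    show "0 \<le> B \<omega>" "B \<omega> \<le> max_rate \<delta> n" "0 \<le> G \<omega>" "G \<omega> \<le> 1" for \<omega>
      using max_rate_pos[OF \<delta>, of n] by (auto simp: B_def G_def)
  qed measurable
  also have "\<dots> = (\<integral>\<omega>. exp (- partial_sum E n \<omega>) * f (weight \<delta> n (\<lambda>j. partial_sum E j \<omega>)) \<partial>M)"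
    using clamp by (intro integral_cong_AE) (measurable, auto simp: weight_def D_def)
  finally show ?thesis .
qed

lemma discounted_weight_le_initial:
  assumes "\<delta> > -1"
    and "\<And>n. drift_bound f f' (max_rate \<delta> n) (1 / (tail_exponent \<delta> + 1)) (1 / tail_exponent \<delta>)"
  shows "(\<integral>\<omega>. exp (- partial_sum E n \<omega>) * f (weight \<delta> n (\<lambda>j. partial_sum E j \<omega>)) \<partial>M)
    \<le> f (tail_exponent \<delta> / (tail_exponent \<delta> + 1) * initial_rate \<delta>)"
proof (induction n)
  case 0
  have "weight \<delta> 0 (\<lambda>j. partial_sum E j \<omega>) = tail_exponent \<delta> / (tail_exponent \<delta> + 1) * initial_rate \<delta>" for \<omega>
    using tail_exponent_gt_1[OF assms(1)]
    by (simp add: weight_def max_rate_def deficit_def partial_sum_def field_simps)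
  then show ?case by (simp add: partial_sum_def prob_space)
next
  case (Suc n)
  then show ?case using discounted_weight_step[OF assms, of n] by linarith
qed

section \<open>The tail as a Laplace transform\<close>

lemma T_measurable [measurable]: "T \<in> borel_measurable M"
  using distributed_measurable[OF T_exponential] by simp

text \<open>A partial sum is measurable with respect to the sigma-algebra generated by the whole sequence \<open>E\<close>,
from which \<open>T\<close> is independent by assumption.\<close>

lemma T_indep_partial_sum: "indep_var borel T borel (partial_sum E n)"
proof -
  let ?V = "\<lambda>\<omega>. \<lambda>j\<in>{1..}. E j \<omega>" and ?L = "\<Pi>\<^sub>M j\<in>{1::nat..}. (borel :: real measure)"
  let ?F = "vimage_algebra (space M) ?V ?L"
  have V: "?V \<in> space M \<rightarrow> space ?L" by (auto simp: space_PiM)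
  have "partial_sum E n \<in> borel_measurable ?F"
  proof -
    have "E j \<in> borel_measurable ?F" if "j \<in> {1..}" for j
      using measurable_compose[OF measurable_vimage_algebra1[OF V] measurable_component_singleton[OF that]] that
      by simp
    then show ?thesis
      unfolding partial_sum_def[abs_def] by (intro borel_measurable_sum) auto
  qed
  then have "{partial_sum E n -` A \<inter> space M |A. A \<in> sets borel} \<subseteq> sets ?F"
    by (auto dest: measurable_sets)
  then have past: "sigma_sets (space M) {partial_sum E n -` A \<inter> space M |A. A \<in> sets borel} \<subseteq> sets ?F"
    using sets.sigma_sets_subset[of _ ?F] by simp
  show ?thesis
    unfolding indep_var_eq
  proof (intro conjI)
    show "indep_set (sigma_sets (space M) {T -` A \<inter> space M |A. A \<in> sets borel})
      (sigma_sets (space M) {partial_sum E n -` A \<inter> space M |A. A \<in> sets borel})"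
      using T_indep unfolding indep_set_def
      by (rule indep_sets_mono_sets)
        (use past in \<open>auto split: bool.split simp: sets_vimage_algebra\<close>)
  qed measurable
qed

lemma prob_partial_sum_le_T:
  "prob {\<omega> \<in> space M. partial_sum E n \<omega> \<le> T \<omega>} = (\<integral>\<omega>. exp (- partial_sum E n \<omega>) \<partial>M)"
proof -
  let ?N = unit_exponential
  let ?D = "distr M borel (partial_sum E n)"
  interpret N: prob_space ?N by (rule prob_space_exponential_density) simp
  interpret D: prob_space ?D by (rule prob_space_distr) simp
  interpret ND: pair_prob_space ?N ?D ..
  have distr_T: "distr M borel T = ?N"
    using distributed_distr_eq_density[OF T_exponential] by (simp cong: distr_cong)
  have joint: "distr M (borel \<Otimes>\<^sub>M borel) (\<lambda>\<omega>. (T \<omega>, partial_sum E n \<omega>)) = ?N \<Otimes>\<^sub>M ?D"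
    using T_indep_partial_sum[of n] unfolding indep_var_distribution_eq distr_T by simp
  define h where "h t x = (if x \<le> t then 1 else 0 :: real)" for t x :: real
  have [measurable]: "case_prod h \<in> borel_measurable (borel \<Otimes>\<^sub>M borel)"
    unfolding h_def by measurable
  have h_int: "integrable (?N \<Otimes>\<^sub>M ?D) (case_prod h)"
    by (rule ND.P.integrable_const_bound[where B = 1]) (auto simp: h_def joint[symmetric])
  have tail: "(\<integral>t. h t x \<partial>?N) = exp (- x)" if "0 \<le> x" for x
  proof -
    \<comment> \<open>The exponential law has no atom at \<open>x\<close>.\<close>
    have "(\<integral>t. h t x \<partial>?N) = (\<integral>t. indicator {x<..} t \<partial>?N)"
      using AE_unit_exponential_neq[of x]
      by (intro integral_cong_AE) (measurable, auto simp: h_def split: split_indicator)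
    also have "\<dots> = measure (distr M borel T) {x<..}" unfolding distr_T by simp
    also have "\<dots> = prob {\<omega> \<in> space M. x < T \<omega>}"
      by (subst measure_distr) (auto intro!: arg_cong[where f = prob])
    also have "\<dots> = exp (- x)"
      using exponential_distributedD_gt[OF T_exponential that] by simp
    finally show ?thesis .
  qed
  have "prob {\<omega> \<in> space M. partial_sum E n \<omega> \<le> T \<omega>} =
      (\<integral>\<omega>. indicator {\<omega> \<in> space M. partial_sum E n \<omega> \<le> T \<omega>} \<omega> \<partial>M)" by simp
  also have "\<dots> = (\<integral>\<omega>. case_prod h (T \<omega>, partial_sum E n \<omega>) \<partial>M)"
    by (intro Bochner_Integration.integral_cong refl) (auto simp: h_def)
  also have "\<dots> = (\<integral>p. case_prod h p \<partial>(?N \<Otimes>\<^sub>M ?D))"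
    unfolding joint[symmetric] by (rule integral_distr[symmetric]) measurable
  also have "\<dots> = (\<integral>x. (\<integral>t. h t x \<partial>?N) \<partial>?D)"
    by (rule ND.integral_snd[symmetric, OF h_int])
  also have "\<dots> = (\<integral>\<omega>. (\<integral>t. h t (partial_sum E n \<omega>) \<partial>?N) \<partial>M)"
    by (rule integral_distr) measurable
  also have "\<dots> = (\<integral>\<omega>. exp (- partial_sum E n \<omega>) \<partial>M)"
    using AE_partial_sum_nonneg[of n]
    by (intro integral_cong_AE) (measurable, auto simp: tail)
  finally show ?thesis .
qed

lemma limit_degree_eq_diff:
  "limit_degree M E T (Suc n) =
    (\<integral>\<omega>. exp (- partial_sum E n \<omega>) \<partial>M) - (\<integral>\<omega>. exp (- partial_sum E (Suc n) \<omega>) \<partial>M)"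
proof -
  let ?S = "\<lambda>n. {\<omega> \<in> space M. partial_sum E n \<omega> \<le> T \<omega>}"
  have "limit_degree M E T (Suc n) = prob (?S n - ?S n \<inter> ?S (Suc n))"
    unfolding limit_degree_def by (rule arg_cong[where f = prob]) (auto simp: partial_sum_def)
  also have "\<dots> = prob (?S n) - prob (?S n \<inter> ?S (Suc n))"
    by (rule finite_measure_Diff) auto
  also have "prob (?S n \<inter> ?S (Suc n)) = prob (?S (Suc n))"
  proof (rule finite_measure_eq_AE)
    show "AE \<omega> in M. \<omega> \<in> ?S n \<inter> ?S (Suc n) \<longleftrightarrow> \<omega> \<in> ?S (Suc n)"
      using AE_partial_sum_mono by eventually_elim (auto intro: order_trans[rotated] simp: le_Suc_eq)
  qed auto
  finally show ?thesis unfolding prob_partial_sum_le_T .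
qed

text \<open>The series telescopes. That its limit term vanishes means that the partial sums tend to infinity;
this follows from the upper bound on the discounted means.\<close>

lemma limit_degree_tail_eq:
  assumes "(\<lambda>n. \<integral>\<omega>. exp (- partial_sum E n \<omega>) \<partial>M) \<longlonglongrightarrow> 0"
  shows "limit_degree_tail M E T (Suc n) = (\<integral>\<omega>. exp (- partial_sum E n \<omega>) \<partial>M)"
proof -
  define a where "a n = (\<integral>\<omega>. exp (- partial_sum E n \<omega>) \<partial>M)" for n
  have "(\<lambda>l. a (l + n)) \<longlonglongrightarrow> 0" using assms unfolding a_def by (rule LIMSEQ_ignore_initial_segment)
  from telescope_sums'[OF this] have "(\<lambda>l. a (l + n) - a (Suc l + n)) sums (a n - 0)" by simp
  then show ?thesis
    unfolding limit_degree_tail_def by (simp add: limit_degree_eq_diff a_def add_ac sums_iff)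
qed

section \<open>Bounds on the discounted means\<close>

lemma integrable_discounted_powr:
  assumes "\<delta> > -1" "0 \<le> b"
  shows "integrable M (\<lambda>\<omega>. exp (- partial_sum E n \<omega>) *
    (weight \<delta> n (\<lambda>j. partial_sum E j \<omega>) + b) powr tail_exponent \<delta>)"
proof (rule integrable_const_bound[where B = "(max_rate \<delta> n + b) powr tail_exponent \<delta>"])
  define p where "p = tail_exponent \<delta>"
  have p: "1 < p" unfolding p_def by (rule tail_exponent_gt_1[OF assms(1)])
  show "AE \<omega> in M. norm (exp (- partial_sum E n \<omega>) *
    (weight \<delta> n (\<lambda>j. partial_sum E j \<omega>) + b) powr tail_exponent \<delta>) \<le> (max_rate \<delta> n + b) powr tail_exponent \<delta>"
    using AE_weight_bounds[OF assms(1), of n]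
  proof eventually_elim
    case (elim \<omega>)
    have "0 \<le> p / (p + 1) * max_rate \<delta> n"
      using p max_rate_pos[OF assms(1), of n] by (intro mult_nonneg_nonneg) auto
    then have "0 \<le> weight \<delta> n (\<lambda>j. partial_sum E j \<omega>)" using elim unfolding p_def by linarith
    then have "exp (- partial_sum E n \<omega>) * (weight \<delta> n (\<lambda>j. partial_sum E j \<omega>) + b) powr p \<le>
      1 * (max_rate \<delta> n + b) powr p"
      using elim p assms(2) by (intro mult_mono powr_mono2) auto
    then show ?case by (simp add: p_def abs_mult)
  qed
qed measurable

text \<open>The nonincreasing mean of \<open>exp (- \<sigma>\<^sub>n) * (X\<^sub>n + b) powr p\<close>, with the weight \<open>X\<^sub>n\<close> replaced by its deterministic
lower bound.\<close>

lemma discounted_mean_upper: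
  assumes "\<delta> > -1"
  defines "p \<equiv> tail_exponent \<delta>"
  defines "b \<equiv> 1 + (p - 1) * exp (p - 1)"
  shows "(p / (p + 1) * max_rate \<delta> n) powr p * (\<integral>\<omega>. exp (- partial_sum E n \<omega>) \<partial>M)
    \<le> (p / (p + 1) * initial_rate \<delta> + b) powr p"
proof -
  have p: "1 < p" unfolding p_def by (rule tail_exponent_gt_1[OF assms(1)])
  have b: "0 \<le> b" using p by (auto simp: b_def)
  have "(p / (p + 1) * max_rate \<delta> n) powr p * (\<integral>\<omega>. exp (- partial_sum E n \<omega>) \<partial>M) =
      (\<integral>\<omega>. (p / (p + 1) * max_rate \<delta> n) powr p * exp (- partial_sum E n \<omega>) \<partial>M)"
    by simp
  also have "\<dots> \<le> (\<integral>\<omega>. exp (- partial_sum E n \<omega>) * (weight \<delta> n (\<lambda>j. partial_sum E j \<omega>) + b) powr p \<partial>M)"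
  proof (rule integral_mono_AE)
    show "integrable M (\<lambda>\<omega>. (p / (p + 1) * max_rate \<delta> n) powr p * exp (- partial_sum E n \<omega>))"
      using AE_partial_sum_nonneg[of n]
      by (intro integrable_mult_right integrable_const_bound[where B = 1]) auto
    show "integrable M (\<lambda>\<omega>. exp (- partial_sum E n \<omega>) * (weight \<delta> n (\<lambda>j. partial_sum E j \<omega>) + b) powr p)"
      unfolding p_def by (rule integrable_discounted_powr[OF assms(1) b])
    show "AE \<omega> in M. (p / (p + 1) * max_rate \<delta> n) powr p * exp (- partial_sum E n \<omega>) \<le>
      exp (- partial_sum E n \<omega>) * (weight \<delta> n (\<lambda>j. partial_sum E j \<omega>) + b) powr p"
      using AE_weight_bounds[OF assms(1), of n]
    proof eventually_elim
      case (elim \<omega>)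
      have "(p / (p + 1) * max_rate \<delta> n) powr p \<le> (weight \<delta> n (\<lambda>j. partial_sum E j \<omega>) + b) powr p"
        using elim b p max_rate_pos[OF assms(1), of n] unfolding p_def[symmetric]
        by (intro powr_mono2) (auto simp del: times_divide_eq_left)
      then show ?case by (subst mult.commute) (intro mult_left_mono, auto)
    qed
  qed
  also have "\<dots> \<le> (p / (p + 1) * initial_rate \<delta> + b) powr p"
    unfolding p_def b_def
    by (rule discounted_weight_le_initial[OF assms(1) drift_bound_powr[OF assms(1)]])
  finally show ?thesis .
qed

text \<open>The nondecreasing mean of \<open>exp (- \<sigma>\<^sub>n) * X\<^sub>n powr p\<close>, with the weight \<open>X\<^sub>n\<close> replaced by its deterministic
upper bound.\<close>

lemma discounted_mean_lower:
  assumes "\<delta> > -1"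
  defines "p \<equiv> tail_exponent \<delta>"
  shows "(p / (p + 1) * initial_rate \<delta>) powr p
    \<le> (max_rate \<delta> n) powr p * (\<integral>\<omega>. exp (- partial_sum E n \<omega>) \<partial>M)"
proof -
  have p: "1 < p" unfolding p_def by (rule tail_exponent_gt_1[OF assms(1)])
  have "(p / (p + 1) * initial_rate \<delta>) powr p \<le>
      (\<integral>\<omega>. exp (- partial_sum E n \<omega>) * weight \<delta> n (\<lambda>j. partial_sum E j \<omega>) powr p \<partial>M)"
    using discounted_weight_le_initial[OF assms(1) drift_bound_minus_powr[OF assms(1)], of n]
    by (simp add: p_def)
  also have "\<dots> \<le> (\<integral>\<omega>. (max_rate \<delta> n) powr p * exp (- partial_sum E n \<omega>) \<partial>M)"
  proof (rule integral_mono_AE)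
    show "integrable M (\<lambda>\<omega>. (max_rate \<delta> n) powr p * exp (- partial_sum E n \<omega>))"
      using AE_partial_sum_nonneg[of n]
      by (intro integrable_mult_right integrable_const_bound[where B = 1]) auto
    show "integrable M (\<lambda>\<omega>. exp (- partial_sum E n \<omega>) * weight \<delta> n (\<lambda>j. partial_sum E j \<omega>) powr p)"
      using integrable_discounted_powr[OF assms(1) order_refl, of n] by (simp add: p_def)
    show "AE \<omega> in M. exp (- partial_sum E n \<omega>) * weight \<delta> n (\<lambda>j. partial_sum E j \<omega>) powr p \<le>
      (max_rate \<delta> n) powr p * exp (- partial_sum E n \<omega>)"
      using AE_weight_bounds[OF assms(1), of n]
    proof eventually_elim
      case (elim \<omega>)
      have "0 \<le> p / (p + 1) * max_rate \<delta> n"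
        using p max_rate_pos[OF assms(1), of n] by (intro mult_nonneg_nonneg) auto
      then have "weight \<delta> n (\<lambda>j. partial_sum E j \<omega>) powr p \<le> (max_rate \<delta> n) powr p"
        using elim p unfolding p_def[symmetric] by (intro powr_mono2) auto
      then show ?case by (subst (2) mult.commute) (intro mult_left_mono, auto)
    qed
  qed
  finally show ?thesis by simp
qed

end

theorem theorem2p4:
  fixes \<delta> :: real
  assumes "\<delta> > -1"
  shows "\<exists>C1 > 0. \<exists>C2 > 0. \<forall>(M :: 'a measure) E T. self_reinforced_model M \<delta> E T \<longrightarrow>
    (\<forall>k\<ge>1. C1 * real k powr (- tail_exponent \<delta>) \<le> limit_degree_tail M E T k
          \<and> limit_degree_tail M E T k \<le> C2 * real k powr (- tail_exponent \<delta>))"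
proof -
  define p where "p = tail_exponent \<delta>"
  define c where "c = p / (p + 1)"
  define K where "K = (c * initial_rate \<delta> + (1 + (p - 1) * exp (p - 1))) powr p"
  define m where "m = min (initial_rate \<delta>) (point_rate \<delta>)"
  define w where "w = max (initial_rate \<delta>) (point_rate \<delta>)"
  have p: "1 < p" unfolding p_def by (rule tail_exponent_gt_1[OF assms])
  have c: "0 < c" using p by (simp add: c_def)
  note rates = rates_pos[OF assms]
  have mw: "0 < m" "0 < w" using rates by (auto simp: m_def w_def)
  \<comment> \<open>With \<open>n + 1 = k\<close>, the maximal rate lies between \<open>m * k\<close> and \<open>w * k\<close>; the constants are what the bounds on the discounted means then give.\<close>
  define C1 where "C1 = (c * initial_rate \<delta> / w) powr p"
  define C2 where "C2 = K / (c * m) powr p"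
  have "0 < c * initial_rate \<delta> + (1 + (p - 1) * exp (p - 1))"
    using c rates p by (intro add_pos_pos add_pos_nonneg) auto
  then have C: "0 < C1" "0 < C2"
    using c rates mw by (auto simp: C1_def C2_def K_def)
  have "C1 * real k powr (- p) \<le> limit_degree_tail M E T k \<and> limit_degree_tail M E T k \<le> C2 * real k powr (- p)"
    if model: "self_reinforced_model M \<delta> E T" and "1 \<le> k" for M :: "'a measure" and E T k
  proof -
    interpret self_reinforced_model M \<delta> E T by fact
    define a where "a n = (\<integral>\<omega>. exp (- partial_sum E n \<omega>) \<partial>M)" for n
    have a_nonneg: "0 \<le> a n" for n unfolding a_def by simp
    have upper: "a n \<le> C2 * real (Suc n) powr (- p)" for n
    proof -
      have "(c * m) powr p * real (Suc n) powr p * a n = (c * (m * real (Suc n))) powr p * a n"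
        using c mw by (simp add: powr_mult mult_ac)
      also have "\<dots> \<le> (c * max_rate \<delta> n) powr p * a n"
        using max_rate_bounds(1)[OF assms, of n] c mw p a_nonneg
        by (intro mult_right_mono powr_mono2 mult_left_mono) (auto simp: m_def)
      also have "\<dots> \<le> K"
        using discounted_mean_upper[OF assms, of n] by (simp add: a_def K_def c_def p_def)
      finally show ?thesis
        using c mw by (simp add: C2_def powr_minus field_simps)
    qed
    have lower: "C1 * real (Suc n) powr (- p) \<le> a n" for n
    proof -
      have "(c * initial_rate \<delta>) powr p \<le> max_rate \<delta> n powr p * a n"
        using discounted_mean_lower[OF assms, of n] by (simp add: a_def c_def p_def)
      also have "\<dots> \<le> (w * real (Suc n)) powr p * a n"
        using max_rate_bounds(2)[OF assms, of n] max_rate_pos[OF assms, of n] p a_nonneg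
        by (intro mult_right_mono powr_mono2) (auto simp: w_def)
      also have "\<dots> = w powr p * real (Suc n) powr p * a n"
        using mw by (simp add: powr_mult)
      finally show ?thesis
        using c mw rates by (simp add: C1_def powr_minus powr_divide field_simps)
    qed
    have "a \<longlonglongrightarrow> 0"
    proof (rule tendsto_sandwich[OF _ _ tendsto_const])
      have "(\<lambda>n. real (Suc n) powr (- p)) \<longlonglongrightarrow> 0"
        using p by (intro tendsto_neg_powr filterlim_compose[OF filterlim_real_sequentially filterlim_Suc]) auto
      then show "(\<lambda>n. C2 * real (Suc n) powr (- p)) \<longlonglongrightarrow> 0"
        by (rule tendsto_mult_right_zero)
    qed (auto simp: a_nonneg upper simp del: of_nat_Suc)
    then have "limit_degree_tail M E T (Suc n) = a n" for n
      unfolding a_def by (rule limit_degree_tail_eq)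
    then show ?thesis using upper[of "k - 1"] lower[of "k - 1"] \<open>1 \<le> k\<close> by (cases k) auto
  qed
  then show ?thesis using C unfolding p_def by blast
qed

end
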